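(* Let $D$ be a continuous dcpo with a basis $B$. Each of the following four conditions on $B$ implies that $\{\{x\in D\mid b\ll x\}\mid b\in B\}$ is a $\lnot\lnot$-stable basis for the Scott topology on $D$: (i) for every $a,b\in B$, if $\lnot\lnot(a\ll b)$, then $a\ll b$; (ii) for every $a,b\in B$, if $\lnot\lnot(a\sqsubseteq b)$, then $a\sqsubseteq b$; (iii) for every $a,b\in B$, it is decidable whether $a\ll b$; (iv) for every $a,b\in B$, it is decidable whether $a\sqsubseteq b$. Hence, if one of these conditions holds, then the Scott topology on $D$ coincides with the apartness topology on $D$ with respect to the intrinsic apartness, i.e. a subset of $D$ is Scott open if and only if it is nearly open.
   Context: Everything is constructive: neither excluded middle nor choice is assumed. A proposition $P$ is decidable if $P\vee\lnot P$ holds. A subset $S$ of a poset is directed if it is inhabited and any two elements of $S$ have an upper bound in $S$. A dcpo is a poset $(D,\sqsubseteq)$ in which every directed subset $S$ has a supremum $\bigsqcup S$. Write $x\ll y$ ($x$ is way below $y$) if for every directed $S$ with $y\sqsubseteq\bigsqcup S$ there is $s\in S$ with $x\sqsubseteq s$. $D$ is continuous if for every $x$ the set $\{y\in D\mid y\ll x\}$ is directed with supremum $x$. A basis of a dcpo $D$ is a subset $B\subseteq D$ such that for every $x\in D$ the set $\{b\in B\mid b\ll x\}$ is directed with supremum $x$. A subset $U\subseteq D$ is Scott open if it is an upper set and whenever $\bigsqcup S\in U$ with $S$ directed, some $s\in S$ is in $U$. The intrinsic apartness on $D$: $x\mathrel{\#}y$ if there is a Scott open set containing $x$ but not $y$,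 or a Scott open set containing $y$ but not $x$. For a topological space $X$ with an apartness $\#$ (an irreflexive symmetric relation) and $A\subseteq X$: the logical complement is $\lnot A=\{x\in X\mid x\notin A\}$; the complement is ${\sim}A=\{x\in X\mid\forall_{y\in A}\,x\mathrel{\#}y\}$; the interior $Y^\circ$ of $Y$ is the largest open set contained in $Y$; the apartness complement is $-A=({\sim}A)^\circ$. Subsets of the form $-A$ are called nearly open; the apartness topology on $X$ is the topology whose basic opens are the nearly open subsets of $X$. A basis $\mathcal B$ of the topology of $X$ is $\lnot\lnot$-stable if $U=(\lnot\lnot U)^\circ$ for every $U\in\mathcal B$.
   Formalization: In the final clause "nearly open" is read as "a union of nearly open sets", i.e. open in the apartness topology; with "nearly open" meaning exactly of the form −A, the clause already fails constructively on the one-point dcpo, where it would imply excluded middle. *)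

theory Defs
  imports Main
begin

text \<open>
  The theorem is a theorem of constructive mathematics: in classical HOL every hypothesis of the
  form "if not not P then P" or "P or not P" is void, and every open set satisfies the double
  negation condition.  We therefore formalise intuitionistic second-order predicate logic (full
  comprehension, no excluded middle, no choice) as an object logic, write the mathematical notions
  as formulas of that logic, and assert derivability.

  There are two sorts: points (the elements of \<open>D\<close>) and subsets of \<open>D\<close>.  The only non-logical
  symbol is the order.  Following Gentzen and Prawitz, bound variables \<open>Bd x\<close> and parameters
  \<open>Par a\<close> (free variables) are kept apart, so that replacing a bound variable by a parameter never
  captures.  The two sorts have separate name spaces: whether a variable denotes a point or a
  subset is determined by its position in a formula.
\<close>

section \<open>Intuitionistic second-order logic\<close>

datatype var = Bd nat | Par nat

datatype fm =
    Falsum                  ("\<^bold>\<bottom>")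
  | Le var var              (infix "\<^bold>\<sqsubseteq>" 50)
  | Eq var var              (infix "\<^bold>=" 50)
  | In var var
  | And fm fm               (infixr "\<^bold>\<and>" 35)
  | Or fm fm                (infixr "\<^bold>\<or>" 30)
  | Imp fm fm               (infixr "\<^bold>\<longrightarrow>" 25)
  | Forall1 nat fm
  | Exists1 nat fm
  | Forall2 nat fm
  | Exists2 nat fm

definition Neg :: "fm \<Rightarrow> fm" ("\<^bold>\<not> _" [40] 40)
  where "(\<^bold>\<not> p) = (p \<^bold>\<longrightarrow> \<^bold>\<bottom>)"

definition Iff :: "fm \<Rightarrow> fm \<Rightarrow> fm" (infix "\<^bold>\<longleftrightarrow>" 25)
  where "(p \<^bold>\<longleftrightarrow> q) = ((p \<^bold>\<longrightarrow> q) \<^bold>\<and> (q \<^bold>\<longrightarrow> p))"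

definition put :: "nat \<Rightarrow> nat \<Rightarrow> var \<Rightarrow> var"
  where "put x a v = (if v = Bd x then Par a else v)"

text \<open>\<open>inst1 x a p\<close> and \<open>inst2 X A p\<close> replace the free occurrences of the point variable \<open>Bd x\<close>
  by the point parameter \<open>a\<close>, resp.\ of the set variable \<open>Bd X\<close> by the set parameter \<open>A\<close>.\<close>

primrec inst1 :: "nat \<Rightarrow> nat \<Rightarrow> fm \<Rightarrow> fm" where
  "inst1 x a \<^bold>\<bottom> = \<^bold>\<bottom>"
| "inst1 x a (s \<^bold>\<sqsubseteq> t) = (put x a s \<^bold>\<sqsubseteq> put x a t)"
| "inst1 x a (s \<^bold>= t) = (put x a s \<^bold>= put x a t)"
| "inst1 x a (In s T) = In (put x a s) T"
| "inst1 x a (p \<^bold>\<and> q) = (inst1 x a p \<^bold>\<and> inst1 x a q)"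
| "inst1 x a (p \<^bold>\<or> q) = (inst1 x a p \<^bold>\<or> inst1 x a q)"
| "inst1 x a (p \<^bold>\<longrightarrow> q) = (inst1 x a p \<^bold>\<longrightarrow> inst1 x a q)"
| "inst1 x a (Forall1 y p) = Forall1 y (if y = x then p else inst1 x a p)"
| "inst1 x a (Exists1 y p) = Exists1 y (if y = x then p else inst1 x a p)"
| "inst1 x a (Forall2 Y p) = Forall2 Y (inst1 x a p)"
| "inst1 x a (Exists2 Y p) = Exists2 Y (inst1 x a p)"

primrec inst2 :: "nat \<Rightarrow> nat \<Rightarrow> fm \<Rightarrow> fm" where
  "inst2 X A \<^bold>\<bottom> = \<^bold>\<bottom>"
| "inst2 X A (s \<^bold>\<sqsubseteq> t) = (s \<^bold>\<sqsubseteq> t)"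
| "inst2 X A (s \<^bold>= t) = (s \<^bold>= t)"
| "inst2 X A (In s T) = In s (put X A T)"
| "inst2 X A (p \<^bold>\<and> q) = (inst2 X A p \<^bold>\<and> inst2 X A q)"
| "inst2 X A (p \<^bold>\<or> q) = (inst2 X A p \<^bold>\<or> inst2 X A q)"
| "inst2 X A (p \<^bold>\<longrightarrow> q) = (inst2 X A p \<^bold>\<longrightarrow> inst2 X A q)"
| "inst2 X A (Forall1 y p) = Forall1 y (inst2 X A p)"
| "inst2 X A (Exists1 y p) = Exists1 y (inst2 X A p)"
| "inst2 X A (Forall2 Y p) = Forall2 Y (if Y = X then p else inst2 X A p)"
| "inst2 X A (Exists2 Y p) = Exists2 Y (if Y = X then p else inst2 X A p)"

text \<open>Free variables (bound-variable names that are not captured, and parameters) of either sort.\<close>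

primrec vars1 :: "fm \<Rightarrow> var set" where
  "vars1 \<^bold>\<bottom> = {}"
| "vars1 (s \<^bold>\<sqsubseteq> t) = {s, t}"
| "vars1 (s \<^bold>= t) = {s, t}"
| "vars1 (In s T) = {s}"
| "vars1 (p \<^bold>\<and> q) = vars1 p \<union> vars1 q"
| "vars1 (p \<^bold>\<or> q) = vars1 p \<union> vars1 q"
| "vars1 (p \<^bold>\<longrightarrow> q) = vars1 p \<union> vars1 q"
| "vars1 (Forall1 y p) = vars1 p - {Bd y}"
| "vars1 (Exists1 y p) = vars1 p - {Bd y}"
| "vars1 (Forall2 Y p) = vars1 p"
| "vars1 (Exists2 Y p) = vars1 p"

primrec vars2 :: "fm \<Rightarrow> var set" where
  "vars2 \<^bold>\<bottom> = {}"
| "vars2 (s \<^bold>\<sqsubseteq> t) = {}"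
| "vars2 (s \<^bold>= t) = {}"
| "vars2 (In s T) = {T}"
| "vars2 (p \<^bold>\<and> q) = vars2 p \<union> vars2 q"
| "vars2 (p \<^bold>\<or> q) = vars2 p \<union> vars2 q"
| "vars2 (p \<^bold>\<longrightarrow> q) = vars2 p \<union> vars2 q"
| "vars2 (Forall1 y p) = vars2 p"
| "vars2 (Exists1 y p) = vars2 p"
| "vars2 (Forall2 Y p) = vars2 p - {Bd Y}"
| "vars2 (Exists2 Y p) = vars2 p - {Bd Y}"

text \<open>
  Natural deduction.  In \<open>\<Delta>; \<Gamma> \<turnstile> p\<close>, \<open>\<Gamma>\<close> is the set of hypotheses and \<open>\<Delta>\<close> the set of point parameters
  assumed to denote elements of \<open>D\<close>.  Declaring the point parameters is what keeps \<open>D\<close> possibly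
  empty: otherwise \<open>\<exists>x. \<top>\<close> would be derivable.  Set parameters need no declaration, since there
  always is a subset of \<open>D\<close> (the empty one).
\<close>

inductive derivable :: "nat set \<Rightarrow> fm set \<Rightarrow> fm \<Rightarrow> bool" ("_; _ \<turnstile> _" [50, 50, 20] 20) where
  Hyp: "p \<in> \<Gamma> \<Longrightarrow> \<Delta>; \<Gamma> \<turnstile> p"
| Weaken: "\<lbrakk>\<Delta>; \<Gamma> \<turnstile> p; \<Delta> \<subseteq> \<Delta>'; \<Gamma> \<subseteq> \<Gamma>'\<rbrakk> \<Longrightarrow> \<Delta>'; \<Gamma>' \<turnstile> p"
| FalsumE: "\<Delta>; \<Gamma> \<turnstile> \<^bold>\<bottom> \<Longrightarrow> \<Delta>; \<Gamma> \<turnstile> p"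
| AndI: "\<lbrakk>\<Delta>; \<Gamma> \<turnstile> p; \<Delta>; \<Gamma> \<turnstile> q\<rbrakk> \<Longrightarrow> \<Delta>; \<Gamma> \<turnstile> p \<^bold>\<and> q"
| AndE1: "\<Delta>; \<Gamma> \<turnstile> p \<^bold>\<and> q \<Longrightarrow> \<Delta>; \<Gamma> \<turnstile> p"
| AndE2: "\<Delta>; \<Gamma> \<turnstile> p \<^bold>\<and> q \<Longrightarrow> \<Delta>; \<Gamma> \<turnstile> q"
| OrI1: "\<Delta>; \<Gamma> \<turnstile> p \<Longrightarrow> \<Delta>; \<Gamma> \<turnstile> p \<^bold>\<or> q"
| OrI2: "\<Delta>; \<Gamma> \<turnstile> q \<Longrightarrow> \<Delta>; \<Gamma> \<turnstile> p \<^bold>\<or> q"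
| OrE: "\<lbrakk>\<Delta>; \<Gamma> \<turnstile> p \<^bold>\<or> q; \<Delta>; insert p \<Gamma> \<turnstile> r; \<Delta>; insert q \<Gamma> \<turnstile> r\<rbrakk> \<Longrightarrow> \<Delta>; \<Gamma> \<turnstile> r"
| ImpI: "\<Delta>; insert p \<Gamma> \<turnstile> q \<Longrightarrow> \<Delta>; \<Gamma> \<turnstile> p \<^bold>\<longrightarrow> q"
| ImpE: "\<lbrakk>\<Delta>; \<Gamma> \<turnstile> p \<^bold>\<longrightarrow> q; \<Delta>; \<Gamma> \<turnstile> p\<rbrakk> \<Longrightarrow> \<Delta>; \<Gamma> \<turnstile> q"
| Forall1I: "\<lbrakk>insert a \<Delta>; \<Gamma> \<turnstile> inst1 x a p;
    a \<notin> \<Delta>; \<forall>q\<in>insert p \<Gamma>. Par a \<notin> vars1 q\<rbrakk> \<Longrightarrow> \<Delta>; \<Gamma> \<turnstile> Forall1 x p"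
| Forall1E: "\<lbrakk>\<Delta>; \<Gamma> \<turnstile> Forall1 x p; a \<in> \<Delta>\<rbrakk> \<Longrightarrow> \<Delta>; \<Gamma> \<turnstile> inst1 x a p"
| Exists1I: "\<lbrakk>\<Delta>; \<Gamma> \<turnstile> inst1 x a p; a \<in> \<Delta>\<rbrakk> \<Longrightarrow> \<Delta>; \<Gamma> \<turnstile> Exists1 x p"
| Exists1E: "\<lbrakk>\<Delta>; \<Gamma> \<turnstile> Exists1 x p; insert a \<Delta>; insert (inst1 x a p) \<Gamma> \<turnstile> r;
    a \<notin> \<Delta>; \<forall>q\<in>insert r (insert p \<Gamma>). Par a \<notin> vars1 q\<rbrakk> \<Longrightarrow> \<Delta>; \<Gamma> \<turnstile> r"
| Forall2I: "\<lbrakk>\<Delta>; \<Gamma> \<turnstile> inst2 X A p; \<forall>q\<in>insert p \<Gamma>. Par A \<notin> vars2 q\<rbrakk> \<Longrightarrow> \<Delta>; \<Gamma> \<turnstile> Forall2 X p"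
| Forall2E: "\<Delta>; \<Gamma> \<turnstile> Forall2 X p \<Longrightarrow> \<Delta>; \<Gamma> \<turnstile> inst2 X A p"
| Exists2I: "\<Delta>; \<Gamma> \<turnstile> inst2 X A p \<Longrightarrow> \<Delta>; \<Gamma> \<turnstile> Exists2 X p"
| Exists2E: "\<lbrakk>\<Delta>; \<Gamma> \<turnstile> Exists2 X p; \<Delta>; insert (inst2 X A p) \<Gamma> \<turnstile> r;
    \<forall>q\<in>insert r (insert p \<Gamma>). Par A \<notin> vars2 q\<rbrakk> \<Longrightarrow> \<Delta>; \<Gamma> \<turnstile> r"
| EqI: "\<Delta>; \<Gamma> \<turnstile> Par a \<^bold>= Par a"
| EqE: "\<lbrakk>\<Delta>; \<Gamma> \<turnstile> Par a \<^bold>= Par b; \<Delta>; \<Gamma> \<turnstile> inst1 x a p\<rbrakk> \<Longrightarrow> \<Delta>; \<Gamma> \<turnstile> inst1 x b p"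
| Comprehension: "Bd X \<notin> vars2 p \<Longrightarrow> \<Delta>; \<Gamma> \<turnstile> Exists2 X (Forall1 x (In (Bd x) (Bd X) \<^bold>\<longleftrightarrow> p))"


section \<open>Readable syntax for quantifiers\<close>

text \<open>
  The binders choose the name of the bound variable: it is larger than every name bound inside the
  body, so it is not captured there.  Subsets are written as predicates on points, both for set
  variables (\<open>S x\<close> stands for \<open>In x S\<close>) and for defined subsets \<open>{x. p x}\<close>, so the set binders
  supply the predicate \<open>\<lambda>x. In x (Bd n)\<close>.
\<close>

type_synonym pred = "var \<Rightarrow> fm"

primrec name_bound :: "fm \<Rightarrow> nat" where
  "name_bound \<^bold>\<bottom> = 0"
| "name_bound (s \<^bold>\<sqsubseteq> t) = 0"
| "name_bound (s \<^bold>= t) = 0"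
| "name_bound (In s T) = 0"
| "name_bound (p \<^bold>\<and> q) = max (name_bound p) (name_bound q)"
| "name_bound (p \<^bold>\<or> q) = max (name_bound p) (name_bound q)"
| "name_bound (p \<^bold>\<longrightarrow> q) = max (name_bound p) (name_bound q)"
| "name_bound (Forall1 y p) = max (Suc y) (name_bound p)"
| "name_bound (Exists1 y p) = max (Suc y) (name_bound p)"
| "name_bound (Forall2 Y p) = max (Suc Y) (name_bound p)"
| "name_bound (Exists2 Y p) = max (Suc Y) (name_bound p)"

definition all1 :: "(var \<Rightarrow> fm) \<Rightarrow> fm" (binder "\<^bold>\<forall>" 10)
  where "(\<^bold>\<forall>x. F x) = (let n = name_bound (F (Bd 0)) in Forall1 n (F (Bd n)))"

definition ex1 :: "(var \<Rightarrow> fm) \<Rightarrow> fm" (binder "\<^bold>\<exists>" 10)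
  where "(\<^bold>\<exists>x. F x) = (let n = name_bound (F (Bd 0)) in Exists1 n (F (Bd n)))"

definition all2 :: "(pred \<Rightarrow> fm) \<Rightarrow> fm" (binder "\<^bold>\<forall>\<^sub>s\<^sub>e\<^sub>t" 10)
  where "(\<^bold>\<forall>\<^sub>s\<^sub>e\<^sub>tS. F S) =
    (let n = name_bound (F (\<lambda>x. In x (Bd 0))) in Forall2 n (F (\<lambda>x. In x (Bd n))))"

definition ex2 :: "(pred \<Rightarrow> fm) \<Rightarrow> fm" (binder "\<^bold>\<exists>\<^sub>s\<^sub>e\<^sub>t" 10)
  where "(\<^bold>\<exists>\<^sub>s\<^sub>e\<^sub>tS. F S) =
    (let n = name_bound (F (\<lambda>x. In x (Bd 0))) in Exists2 n (F (\<lambda>x. In x (Bd n))))"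

definition subset :: "pred \<Rightarrow> pred \<Rightarrow> fm" (infix "\<^bold>\<subseteq>" 50)
  where "(S \<^bold>\<subseteq> T) = (\<^bold>\<forall>x. S x \<^bold>\<longrightarrow> T x)"

definition set_eq :: "pred \<Rightarrow> pred \<Rightarrow> fm" (infix "\<^bold>\<doteq>" 50)
  where "(S \<^bold>\<doteq> T) = (\<^bold>\<forall>x. S x \<^bold>\<longleftrightarrow> T x)"

definition decidable :: "fm \<Rightarrow> fm"
  where "decidable p = (p \<^bold>\<or> \<^bold>\<not> p)"


section \<open>Continuous dcpos\<close>

definition poset :: fm where
  "poset = ((\<^bold>\<forall>x. x \<^bold>\<sqsubseteq> x)
    \<^bold>\<and> (\<^bold>\<forall>x. \<^bold>\<forall>y. \<^bold>\<forall>z. x \<^bold>\<sqsubseteq> y \<^bold>\<longrightarrow> y \<^bold>\<sqsubseteq> z \<^bold>\<longrightarrow> x \<^bold>\<sqsubseteq> z)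
    \<^bold>\<and> (\<^bold>\<forall>x. \<^bold>\<forall>y. x \<^bold>\<sqsubseteq> y \<^bold>\<longrightarrow> y \<^bold>\<sqsubseteq> x \<^bold>\<longrightarrow> x \<^bold>= y))"

definition directed :: "pred \<Rightarrow> fm" where
  "directed S = ((\<^bold>\<exists>x. S x)
    \<^bold>\<and> (\<^bold>\<forall>x. \<^bold>\<forall>y. S x \<^bold>\<longrightarrow> S y \<^bold>\<longrightarrow> (\<^bold>\<exists>z. S z \<^bold>\<and> x \<^bold>\<sqsubseteq> z \<^bold>\<and> y \<^bold>\<sqsubseteq> z)))"

definition is_sup :: "pred \<Rightarrow> var \<Rightarrow> fm" where
  "is_sup S u = ((\<^bold>\<forall>x. S x \<^bold>\<longrightarrow> x \<^bold>\<sqsubseteq> u) \<^bold>\<and> (\<^bold>\<forall>v. (\<^bold>\<forall>x. S x \<^bold>\<longrightarrow> x \<^bold>\<sqsubseteq> v) \<^bold>\<longrightarrow> u \<^bold>\<sqsubseteq> v))"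

definition dcpo :: fm where
  "dcpo = (poset \<^bold>\<and> (\<^bold>\<forall>\<^sub>s\<^sub>e\<^sub>tS. directed S \<^bold>\<longrightarrow> (\<^bold>\<exists>u. is_sup S u)))"

definition way_below :: "var \<Rightarrow> var \<Rightarrow> fm" (infix "\<^bold>\<lless>" 50) where
  "(x \<^bold>\<lless> y) =
    (\<^bold>\<forall>\<^sub>s\<^sub>e\<^sub>tS. directed S \<^bold>\<longrightarrow> (\<^bold>\<forall>u. is_sup S u \<^bold>\<longrightarrow> y \<^bold>\<sqsubseteq> u \<^bold>\<longrightarrow> (\<^bold>\<exists>s. S s \<^bold>\<and> x \<^bold>\<sqsubseteq> s)))"

definition continuous_dcpo :: fm where
  "continuous_dcpo = (dcpo \<^bold>\<and> (\<^bold>\<forall>x. directed (\<lambda>y. y \<^bold>\<lless> x) \<^bold>\<and> is_sup (\<lambda>y. y \<^bold>\<lless> x) x))"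

definition dcpo_basis :: "pred \<Rightarrow> fm" where
  "dcpo_basis B =
    (\<^bold>\<forall>x. directed (\<lambda>b. B b \<^bold>\<and> b \<^bold>\<lless> x) \<^bold>\<and> is_sup (\<lambda>b. B b \<^bold>\<and> b \<^bold>\<lless> x) x)"

definition scott_open :: "pred \<Rightarrow> fm" where
  "scott_open U = ((\<^bold>\<forall>x. \<^bold>\<forall>y. U x \<^bold>\<longrightarrow> x \<^bold>\<sqsubseteq> y \<^bold>\<longrightarrow> U y)
    \<^bold>\<and> (\<^bold>\<forall>\<^sub>s\<^sub>e\<^sub>tS. directed S \<^bold>\<longrightarrow> (\<^bold>\<forall>u. is_sup S u \<^bold>\<longrightarrow> U u \<^bold>\<longrightarrow> (\<^bold>\<exists>s. S s \<^bold>\<and> U s))))"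

definition apart :: "var \<Rightarrow> var \<Rightarrow> fm" (infix "\<^bold>\<sharp>" 50) where
  "(x \<^bold>\<sharp> y) = ((\<^bold>\<exists>\<^sub>s\<^sub>e\<^sub>tU. scott_open U \<^bold>\<and> U x \<^bold>\<and> \<^bold>\<not> U y) \<^bold>\<or> (\<^bold>\<exists>\<^sub>s\<^sub>e\<^sub>tU. scott_open U \<^bold>\<and> U y \<^bold>\<and> \<^bold>\<not> U x))"


section \<open>Spaces with an apartness relation\<close>

text \<open>A family of subsets, such as a topology or a basis, is given by the formula defining it,
  as a function of the subset; all families needed here are definable.  In what follows \<open>\<O>\<close> is a topology and \<open>R\<close> an apartness.\<close>

type_synonym family = "pred \<Rightarrow> fm"

definition log_compl :: "pred \<Rightarrow> pred"
  where "log_compl A = (\<lambda>x. \<^bold>\<not> A x)"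

definition compl :: "(var \<Rightarrow> var \<Rightarrow> fm) \<Rightarrow> pred \<Rightarrow> pred"
  where "compl R A = (\<lambda>x. \<^bold>\<forall>y. A y \<^bold>\<longrightarrow> R x y)"

definition interior :: "family \<Rightarrow> pred \<Rightarrow> pred"
  where "interior \<O> Y = (\<lambda>x. \<^bold>\<exists>\<^sub>s\<^sub>e\<^sub>tU. \<O> U \<^bold>\<and> U \<^bold>\<subseteq> Y \<^bold>\<and> U x)"

definition apart_compl :: "family \<Rightarrow> (var \<Rightarrow> var \<Rightarrow> fm) \<Rightarrow> pred \<Rightarrow> pred"
  where "apart_compl \<O> R A = interior \<O> (compl R A)"

definition nearly_open :: "family \<Rightarrow> (var \<Rightarrow> var \<Rightarrow> fm) \<Rightarrow> family"
  where "nearly_open \<O> R = (\<lambda>N. \<^bold>\<exists>\<^sub>s\<^sub>e\<^sub>tA. N \<^bold>\<doteq> apart_compl \<O> R A)"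

definition topology_with_basic_opens :: "family \<Rightarrow> family"
  where "topology_with_basic_opens \<B> =
    (\<lambda>U. \<^bold>\<forall>x. U x \<^bold>\<longrightarrow> (\<^bold>\<exists>\<^sub>s\<^sub>e\<^sub>tV. \<B> V \<^bold>\<and> V \<^bold>\<subseteq> U \<^bold>\<and> V x))"

text \<open>The open sets of the apartness topology are the unions of nearly open sets.  They need not be
  of the form \<open>apart_compl \<O> R A\<close> themselves: on a one-point dcpo the latter are the subsets
  \<open>{x. \<not> q}\<close> for propositions \<open>q\<close>, whereas \<open>{x. p}\<close> is Scott open for every proposition \<open>p\<close>.\<close>

definition apartness_topology :: "family \<Rightarrow> (var \<Rightarrow> var \<Rightarrow> fm) \<Rightarrow> family"
  where "apartness_topology \<O> R = topology_with_basic_opens (nearly_open \<O> R)"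

definition topology_basis :: "family \<Rightarrow> family \<Rightarrow> fm"
  where "topology_basis \<O> \<B> = ((\<^bold>\<forall>\<^sub>s\<^sub>e\<^sub>tV. \<B> V \<^bold>\<longrightarrow> \<O> V)
    \<^bold>\<and> (\<^bold>\<forall>\<^sub>s\<^sub>e\<^sub>tU. \<O> U \<^bold>\<longrightarrow> topology_with_basic_opens \<B> U))"

definition notnot_stable_basis :: "family \<Rightarrow> family \<Rightarrow> fm"
  where "notnot_stable_basis \<O> \<B> = (topology_basis \<O> \<B>
    \<^bold>\<and> (\<^bold>\<forall>\<^sub>s\<^sub>e\<^sub>tU. \<B> U \<^bold>\<longrightarrow> U \<^bold>\<doteq> interior \<O> (log_compl (log_compl U))))"

text \<open>The family \<open>{{x. b \<lless> x} | b \<in> B}\<close>.\<close>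

definition way_above_family :: "pred \<Rightarrow> family"
  where "way_above_family B = (\<lambda>U. \<^bold>\<exists>b. B b \<^bold>\<and> U \<^bold>\<doteq> (\<lambda>x. b \<^bold>\<lless> x))"


section \<open>The four conditions\<close>

definition notnot_stable_way_below :: "pred \<Rightarrow> fm" where
  "notnot_stable_way_below B =
    (\<^bold>\<forall>a. \<^bold>\<forall>b. B a \<^bold>\<longrightarrow> B b \<^bold>\<longrightarrow> \<^bold>\<not> \<^bold>\<not> (a \<^bold>\<lless> b) \<^bold>\<longrightarrow> a \<^bold>\<lless> b)"

definition notnot_stable_order :: "pred \<Rightarrow> fm" where
  "notnot_stable_order B =
    (\<^bold>\<forall>a. \<^bold>\<forall>b. B a \<^bold>\<longrightarrow> B b \<^bold>\<longrightarrow> \<^bold>\<not> \<^bold>\<not> (a \<^bold>\<sqsubseteq> b) \<^bold>\<longrightarrow> a \<^bold>\<sqsubseteq> b)"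

definition decidable_way_below :: "pred \<Rightarrow> fm" where
  "decidable_way_below B = (\<^bold>\<forall>a. \<^bold>\<forall>b. B a \<^bold>\<longrightarrow> B b \<^bold>\<longrightarrow> decidable (a \<^bold>\<lless> b))"

definition decidable_order :: "pred \<Rightarrow> fm" where
  "decidable_order B = (\<^bold>\<forall>a. \<^bold>\<forall>b. B a \<^bold>\<longrightarrow> B b \<^bold>\<longrightarrow> decidable (a \<^bold>\<sqsubseteq> b))"

end

theory Submission
  imports Defs "HOL-Library.FSet"
begin

text \<open>
  A context forces a formula if it derives it.  Over all finite contexts this is a Kripke-style
  forcing relation, in which the hypothetical rules become statements about larger contexts, while
  disjunctions and existential quantifiers are eliminated only towards a forced goal (as in Beth
  models).  So derivations can be replaced by informal intuitionistic reasoning about forcing.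

  For the mathematics, each of the four conditions gives: if \<open>\<not>\<not>(a \<lless> b)\<close> for \<open>a, b\<close> in the basis,
  then \<open>a \<sqsubseteq> b\<close>.  Let \<open>W\<close> be Scott open with \<open>\<not>\<not>(b \<lless> y)\<close> for every \<open>y \<in> W\<close>, and let \<open>x \<in> W\<close>.  Some
  basis element \<open>a \<lless> x\<close> lies in \<open>W\<close>, so \<open>b \<sqsubseteq> a \<lless> x\<close>.  With interpolation this yields \<open>\<not>\<not>\<close>-stability of
  \<open>V = {x. b \<lless> x}\<close>, and also that \<open>V\<close> is the apartness complement of its logical complement \<open>\<not>V\<close>: if
  \<open>y\<close> is apart from all points of \<open>\<not>V\<close>, then \<open>\<not>\<not>(y \<in> V)\<close> by irreflexivity.
\<close>

section \<open>Forcing\<close>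

datatype ctx = Ctx (points: "nat fset") (hyps: "fm fset")

instantiation ctx :: preorder
begin
definition "c \<le> d \<longleftrightarrow> points c |\<subseteq>| points d \<and> hyps c |\<subseteq>| hyps d"
definition "c < d \<longleftrightarrow> c \<le> d \<and> \<not> d \<le> (c :: ctx)"
instance by standard (auto simp: less_eq_ctx_def less_ctx_def)
end

definition pts :: "ctx \<Rightarrow> nat set"
  where "pts c = fset (points c)"

definition forces :: "ctx \<Rightarrow> fm \<Rightarrow> bool" (infix "\<tturnstile>" 20)
  where "(c \<tturnstile> p) \<longleftrightarrow> (pts c; fset (hyps c) \<turnstile> p)"

lemma forces_mono: "c \<tturnstile> p \<Longrightarrow> c \<le> d \<Longrightarrow> d \<tturnstile> p"
  unfolding forces_def pts_def less_eq_ctx_def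
  by (rule Weaken) (auto simp: less_eq_fset.rep_eq)

lemma pts_up: "a \<in> pts c \<Longrightarrow> c \<le> d \<Longrightarrow> a \<in> pts d"
  unfolding pts_def less_eq_ctx_def by (auto simp: less_eq_fset.rep_eq)

section \<open>Clauses for the propositional connectives\<close>

lemma forces_Falsum: "c \<tturnstile> \<^bold>\<bottom> \<Longrightarrow> c \<tturnstile> p"
  unfolding forces_def by (rule FalsumE)

lemma forces_And: "(c \<tturnstile> p \<^bold>\<and> q) \<longleftrightarrow> (c \<tturnstile> p) \<and> (c \<tturnstile> q)"
  unfolding forces_def by (blast intro: AndI dest: AndE1 AndE2)

lemma forces_OrI1: "c \<tturnstile> p \<Longrightarrow> c \<tturnstile> p \<^bold>\<or> q"
  unfolding forces_def by (rule OrI1)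

lemma forces_OrI2: "c \<tturnstile> q \<Longrightarrow> c \<tturnstile> p \<^bold>\<or> q"
  unfolding forces_def by (rule OrI2)

text \<open>This is the bridge from forcing in larger contexts back to derivations. The exact
  equations for points and hypotheses match the premises of rules that discharge
  \<open>p\<close>.\<close>

lemma hyp_extension:
  obtains d where "c \<le> d" "d \<tturnstile> p" "pts d = pts c" "fset (hyps d) = insert p (fset (hyps c))"
proof (rule that)
  show "c \<le> Ctx (points c) (finsert p (hyps c))"
    by (auto simp: less_eq_ctx_def less_eq_fset.rep_eq)
qed (auto simp: forces_def pts_def intro: Hyp)

text \<open>A context may derive a disjunction without deriving either disjunct, so the cases are
  taken in larger contexts and brought back to \<open>c\<close> by the elimination rule.\<close>

lemma forces_OrE:
  assumes "c \<tturnstile> p \<^bold>\<or> q"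
    and "\<And>d. c \<le> d \<Longrightarrow> d \<tturnstile> p \<Longrightarrow> d \<tturnstile> r"
    and "\<And>d. c \<le> d \<Longrightarrow> d \<tturnstile> q \<Longrightarrow> d \<tturnstile> r"
  shows "c \<tturnstile> r"
  using assms hyp_extension[of c p] hyp_extension[of c q]
  unfolding forces_def by (metis OrE)

text \<open>Left to right is weakening followed by modus ponens. For the converse it suffices to
  evaluate the right side at the context \<open>c\<close> extended by the hypothesis
  \<open>p\<close>, which yields the premise of implication introduction.\<close>

lemma forces_Imp: "(c \<tturnstile> p \<^bold>\<longrightarrow> q) \<longleftrightarrow> (\<forall>d\<ge>c. (d \<tturnstile> p) \<longrightarrow> (d \<tturnstile> q))"
proof
  assume "c \<tturnstile> p \<^bold>\<longrightarrow> q"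
  then show "\<forall>d\<ge>c. (d \<tturnstile> p) \<longrightarrow> (d \<tturnstile> q)"
    using forces_mono unfolding forces_def by (blast intro: ImpE)
next
  assume "\<forall>d\<ge>c. (d \<tturnstile> p) \<longrightarrow> (d \<tturnstile> q)"
  then show "c \<tturnstile> p \<^bold>\<longrightarrow> q"
    using hyp_extension[of c p] unfolding forces_def by (metis ImpI)
qed

text \<open>Inconsistent contexts belong to the model and force everything. A negation therefore
  does not exclude larger contexts forcing \<open>p\<close>; it makes them force falsum.\<close>

lemma forces_Neg: "(c \<tturnstile> \<^bold>\<not> p) \<longleftrightarrow> (\<forall>d\<ge>c. \<not> (d \<tturnstile> p) \<or> (d \<tturnstile> \<^bold>\<bottom>))"
  by (auto simp: Neg_def forces_Imp)

lemma forces_Iff: "(c \<tturnstile> p \<^bold>\<longleftrightarrow> q) \<longleftrightarrow> (\<forall>d\<ge>c. (d \<tturnstile> p) \<longleftrightarrow> (d \<tturnstile> q))"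
  by (auto simp: Iff_def forces_And forces_Imp)

section \<open>Fresh parameters and clauses for the quantifiers\<close>

lemma finite_vars: "finite (vars1 p)" "finite (vars2 p)"
  by (induction p) auto

text \<open>Each formula has finitely many variables and \<open>Par\<close> is injective, so a
  finite set of formulas together with a finite set of points rules out only finitely many
  parameters.\<close>

lemma fresh1:
  assumes "finite (\<Delta> :: nat set)" "finite \<Gamma>"
  obtains a where "a \<notin> \<Delta>" "\<forall>q\<in>\<Gamma>. Par a \<notin> vars1 q"
proof -
  have "finite (\<Union>q\<in>\<Gamma>. Par -` vars1 q)"
    using assms finite_vars by (auto intro!: finite_vimageI simp: inj_def)
  with assms have "finite (\<Delta> \<union> (\<Union>q\<in>\<Gamma>. Par -` vars1 q))" by simp
  from ex_new_if_finite[OF infinite_UNIV_nat this] show ?thesis using that by auto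
qed

lemma fresh2:
  assumes "finite \<Gamma>"
  obtains A where "\<forall>q\<in>\<Gamma>. Par A \<notin> vars2 q"
proof -
  have "finite (\<Union>q\<in>\<Gamma>. Par -` vars2 q)"
    using assms finite_vars by (auto intro!: finite_vimageI simp: inj_def)
  from ex_new_if_finite[OF infinite_UNIV_nat this] show ?thesis using that by auto
qed

lemma pts_extension:
  obtains d where "c \<le> d" "pts d = insert a (pts c)" "fset (hyps d) = fset (hyps c)"
proof (rule that)
  show "c \<le> Ctx (finsert a (points c)) (hyps c)"
    by (auto simp: less_eq_ctx_def less_eq_fset.rep_eq)
qed (auto simp: pts_def)

text \<open>For the converse, \<open>c\<close> is enlarged by one fresh point: the instance forced
  there is exactly the premise of the introduction rule.\<close>

lemma forces_Forall1: "(c \<tturnstile> Forall1 x p) \<longleftrightarrow> (\<forall>d\<ge>c. \<forall>a\<in>pts d. d \<tturnstile> inst1 x a p)"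
proof
  assume "c \<tturnstile> Forall1 x p"
  then show "\<forall>d\<ge>c. \<forall>a\<in>pts d. d \<tturnstile> inst1 x a p"
    using forces_mono unfolding forces_def by (blast intro: Forall1E)
next
  assume *: "\<forall>d\<ge>c. \<forall>a\<in>pts d. d \<tturnstile> inst1 x a p"
  obtain a where a: "a \<notin> pts c" "\<forall>q\<in>insert p (fset (hyps c)). Par a \<notin> vars1 q"
    by (rule fresh1[of "pts c" "insert p (fset (hyps c))"]) (simp add: pts_def, simp, blast)
  obtain d where "c \<le> d" "pts d = insert a (pts c)" "fset (hyps d) = fset (hyps c)"
    by (rule pts_extension)
  with * a show "c \<tturnstile> Forall1 x p"
    unfolding forces_def by (metis Forall1I insertI1)
qed

lemma forces_Forall2: "(c \<tturnstile> Forall2 X p) \<longleftrightarrow> (\<forall>d\<ge>c. \<forall>A. d \<tturnstile> inst2 X A p)"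
proof
  assume "c \<tturnstile> Forall2 X p"
  then show "\<forall>d\<ge>c. \<forall>A. d \<tturnstile> inst2 X A p"
    using forces_mono unfolding forces_def by (blast intro: Forall2E)
next
  assume *: "\<forall>d\<ge>c. \<forall>A. d \<tturnstile> inst2 X A p"
  \<comment> \<open>Set parameters are not declared in a context, so a fresh one can be used in
    \<open>c\<close> itself.\<close>
  obtain A where "\<forall>q\<in>insert p (fset (hyps c)). Par A \<notin> vars2 q"
    by (rule fresh2[of "insert p (fset (hyps c))"]) (simp, blast)
  with * show "c \<tturnstile> Forall2 X p"
    unfolding forces_def by (metis Forall2I order_refl)
qed

lemma forces_Exists1I: "c \<tturnstile> inst1 x a p \<Longrightarrow> a \<in> pts c \<Longrightarrow> c \<tturnstile> Exists1 x p"
  unfolding forces_def by (rule Exists1I)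

lemma forces_Exists1E:
  assumes "c \<tturnstile> Exists1 x p"
    and "\<And>d a. c \<le> d \<Longrightarrow> a \<in> pts d \<Longrightarrow> d \<tturnstile> inst1 x a p \<Longrightarrow> d \<tturnstile> r"
  shows "c \<tturnstile> r"
proof -
  obtain a where a: "a \<notin> pts c" "\<forall>q\<in>insert r (insert p (fset (hyps c))). Par a \<notin> vars1 q"
    by (rule fresh1[of "pts c" "insert r (insert p (fset (hyps c)))"]) (simp add: pts_def, simp, blast)
  \<comment> \<open>Two extensions reproduce the premise of the elimination rule: \<open>d\<close>
    declares the fresh witness, then \<open>e\<close> adds its instance as a hypothesis.\<close>
  obtain d where d: "c \<le> d" "pts d = insert a (pts c)" "fset (hyps d) = fset (hyps c)"
    by (rule pts_extension)
  obtain e where e: "d \<le> e" "e \<tturnstile> inst1 x a p" "pts e = pts d"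
    "fset (hyps e) = insert (inst1 x a p) (fset (hyps d))" by (rule hyp_extension)
  have "e \<tturnstile> r" using assms(2) d(1,2) e(1-3) by (metis order_trans insertI1)
  with assms(1) a d e show ?thesis
    unfolding forces_def by (metis Exists1E)
qed

lemma forces_Exists2I: "c \<tturnstile> inst2 X A p \<Longrightarrow> c \<tturnstile> Exists2 X p"
  unfolding forces_def by (rule Exists2I)

lemma forces_Exists2E:
  assumes "c \<tturnstile> Exists2 X p"
    and "\<And>d A. c \<le> d \<Longrightarrow> d \<tturnstile> inst2 X A p \<Longrightarrow> d \<tturnstile> r"
  shows "c \<tturnstile> r"
proof -
  obtain A where A: "\<forall>q\<in>insert r (insert p (fset (hyps c))). Par A \<notin> vars2 q"
    by (rule fresh2[of "insert r (insert p (fset (hyps c)))"]) (simp, blast)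
  obtain e where e: "c \<le> e" "e \<tturnstile> inst2 X A p" "pts e = pts c"
    "fset (hyps e) = insert (inst2 X A p) (fset (hyps c))" by (rule hyp_extension)
  with assms A show ?thesis
    unfolding forces_def by (metis Exists2E)
qed

text \<open>\<open>F\<close> is a family of formulas whose dependence on its argument is by substitution.  This holds for
  each concrete formula built with the binders, but not for arbitrary functions from variables to
  formulas.\<close>

definition substitutive1 :: "(var \<Rightarrow> fm) \<Rightarrow> bool" where
  "substitutive1 F \<longleftrightarrow> (\<forall>a. let n = name_bound (F (Bd 0)) in inst1 n a (F (Bd n)) = F (Par a))"

definition substitutive2 :: "(pred \<Rightarrow> fm) \<Rightarrow> bool" where
  "substitutive2 F \<longleftrightarrow> (\<forall>A. let n = name_bound (F (\<lambda>x. In x (Bd 0)))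
    in inst2 n A (F (\<lambda>x. In x (Bd n))) = F (\<lambda>x. In x (Par A)))"

lemma forces_all1: "substitutive1 F \<Longrightarrow> (c \<tturnstile> (\<^bold>\<forall>x. F x)) \<longleftrightarrow> (\<forall>d\<ge>c. \<forall>a\<in>pts d. d \<tturnstile> F (Par a))"
  by (simp add: all1_def substitutive1_def Let_def forces_Forall1)

lemma forces_all2: "substitutive2 F \<Longrightarrow> (c \<tturnstile> (\<^bold>\<forall>\<^sub>s\<^sub>e\<^sub>tS. F S)) \<longleftrightarrow> (\<forall>d\<ge>c. \<forall>A. d \<tturnstile> F (\<lambda>x. In x (Par A)))"
  by (simp add: all2_def substitutive2_def Let_def forces_Forall2)

lemma forces_ex1I: "c \<tturnstile> F (Par a) \<Longrightarrow> a \<in> pts c \<Longrightarrow> substitutive1 F \<Longrightarrow> c \<tturnstile> (\<^bold>\<exists>x. F x)"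
  by (simp add: ex1_def substitutive1_def Let_def forces_Exists1I)

lemma forces_ex1E:
  assumes "c \<tturnstile> (\<^bold>\<exists>x. F x)"
    and "\<And>d a. c \<le> d \<Longrightarrow> a \<in> pts d \<Longrightarrow> d \<tturnstile> F (Par a) \<Longrightarrow> d \<tturnstile> r"
    and "substitutive1 F"
  shows "c \<tturnstile> r"
  using assms(1)
  by (rule forces_Exists1E[of _ "name_bound (F (Bd 0))" "F (Bd (name_bound (F (Bd 0))))",
      folded ex1_def[unfolded Let_def]])
    (use assms in \<open>simp add: substitutive1_def Let_def\<close>)

lemma forces_ex2I: "c \<tturnstile> F (\<lambda>x. In x (Par A)) \<Longrightarrow> substitutive2 F \<Longrightarrow> c \<tturnstile> (\<^bold>\<exists>\<^sub>s\<^sub>e\<^sub>tS. F S)"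
  by (auto simp: ex2_def substitutive2_def Let_def intro: forces_Exists2I)

lemma forces_ex2E:
  assumes "c \<tturnstile> (\<^bold>\<exists>\<^sub>s\<^sub>e\<^sub>tS. F S)"
    and "\<And>d A. c \<le> d \<Longrightarrow> d \<tturnstile> F (\<lambda>x. In x (Par A)) \<Longrightarrow> d \<tturnstile> r"
    and "substitutive2 F"
  shows "c \<tturnstile> r"
  using assms(1)
  by (rule forces_Exists2E[of _ "name_bound (F (\<lambda>x. In x (Bd 0)))"
      "F (\<lambda>x. In x (Bd (name_bound (F (\<lambda>x. In x (Bd 0))))))", folded ex2_def[unfolded Let_def]])
    (use assms in \<open>simp add: substitutive2_def Let_def\<close>)

section \<open>Comprehension\<close>

lemma inst2_not_free: "Bd X \<notin> vars2 p \<Longrightarrow> inst2 X A p = p"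
  by (induction p) (auto simp: put_def)

text \<open>The comprehension axiom is combined with existential elimination, so the new set
  \<open>A\<close> is available in larger contexts only, with an equivalence that persists to all
  contexts above. The condition on \<open>vars2\<close> ensures that the bound set variable of the
  axiom is not free in the defining formula.\<close>

lemma comprehension:
  assumes "substitutive1 F" "\<And>n. vars2 (F (Bd n)) \<subseteq> range Par"
    and "\<And>d A. c \<le> d \<Longrightarrow>
      (\<And>e a. d \<le> e \<Longrightarrow> a \<in> pts e \<Longrightarrow> (e \<tturnstile> In (Par a) (Par A)) \<longleftrightarrow> (e \<tturnstile> F (Par a))) \<Longrightarrow> d \<tturnstile> r"
  shows "c \<tturnstile> r"
proof -
  define n where "n = name_bound (F (Bd 0))"
  have nf: "Bd 0 \<notin> vars2 (F (Bd n))" using assms(2)[of n] by auto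
  have F: "inst1 n a (F (Bd n)) = F (Par a)" for a
    using assms(1) by (simp add: substitutive1_def n_def Let_def)
  \<comment> \<open>The number \<open>0\<close> names the set and \<open>n\<close> names the point;
    even when \<open>n\<close> is \<open>0\<close> they do not clash, because the two sorts have
    separate name spaces.\<close>
  have "c \<tturnstile> Exists2 0 (Forall1 n (In (Bd n) (Bd 0) \<^bold>\<longleftrightarrow> F (Bd n)))"
    unfolding forces_def using nf by (rule Comprehension)
  then show ?thesis
  proof (rule forces_Exists2E)
    fix d A assume d: "c \<le> d" "d \<tturnstile> inst2 0 A (Forall1 n (In (Bd n) (Bd 0) \<^bold>\<longleftrightarrow> F (Bd n)))"
    then have "d \<tturnstile> Forall1 n (In (Bd n) (Par A) \<^bold>\<longleftrightarrow> F (Bd n))"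
      using inst2_not_free[OF nf] by (simp add: Iff_def put_def)
    then have "\<forall>e\<ge>d. \<forall>a\<in>pts e. e \<tturnstile> In (Par a) (Par A) \<^bold>\<longleftrightarrow> F (Par a)"
      by (simp add: forces_Forall1 Iff_def put_def F)
    then have "(e \<tturnstile> In (Par a) (Par A)) \<longleftrightarrow> (e \<tturnstile> F (Par a))" if "d \<le> e" "a \<in> pts e" for e a
      using that unfolding forces_Iff by blast
    then show "d \<tturnstile> r" using assms(3) d(1) by blast
  qed
qed

section \<open>Forcing the notions of domain theory\<close>

abbreviation mem :: "nat \<Rightarrow> pred" where "mem A \<equiv> \<lambda>x. In x (Par A)"

section \<open>Bound names and substitution in the formulas of domain theory\<close>

lemmas binder_defs = all1_def ex1_def all2_def ex2_def Let_def Iff_def Neg_def put_def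

text \<open>The names bound in this formula are exactly those below 3, so substitution for a
  variable numbered 3 or more passes through to the free positions. Equations of this kind establish
  substitutivity of larger formulas without unfolding everything.\<close>

lemma directed_syntax:
  "name_bound (directed (\<lambda>x. In x T)) = 3"
  "3 \<le> n \<Longrightarrow> inst1 n a (directed (\<lambda>x. In x T)) = directed (\<lambda>x. In x T)"
  "3 \<le> n \<Longrightarrow> inst2 n A (directed (\<lambda>x. In x T)) = directed (\<lambda>x. In x (put n A T))"
  "vars2 (directed (\<lambda>x. In x T)) = {T}"
  by (simp_all add: directed_def binder_defs)

lemma is_sup_syntax:
  "name_bound (is_sup (\<lambda>x. In x T) u) = 2"
  "2 \<le> n \<Longrightarrow> inst1 n a (is_sup (\<lambda>x. In x T) u) = is_sup (\<lambda>x. In x T) (put n a u)"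
  "2 \<le> n \<Longrightarrow> inst2 n A (is_sup (\<lambda>x. In x T) u) = is_sup (\<lambda>x. In x (put n A T)) u"
  "vars2 (is_sup (\<lambda>x. In x T) u) = {T}"
  by (simp_all add: is_sup_def binder_defs)

lemmas directed_sup_syntax = directed_syntax is_sup_syntax

lemma way_below_syntax:
  "name_bound (x \<^bold>\<lless> y) = 4"
  "4 \<le> n \<Longrightarrow> inst1 n a (x \<^bold>\<lless> y) = (put n a x \<^bold>\<lless> put n a y)"
  "4 \<le> n \<Longrightarrow> inst2 n A (x \<^bold>\<lless> y) = (x \<^bold>\<lless> y)"
  "vars2 (x \<^bold>\<lless> y) = {}"
  by (simp_all add: way_below_def binder_defs directed_sup_syntax)

lemma scott_open_syntax:
  "name_bound (scott_open (\<lambda>x. In x T)) = 4"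
  "4 \<le> n \<Longrightarrow> inst1 n a (scott_open (\<lambda>x. In x T)) = scott_open (\<lambda>x. In x T)"
  "4 \<le> n \<Longrightarrow> inst2 n A (scott_open (\<lambda>x. In x T)) = scott_open (\<lambda>x. In x (put n A T))"
  by (simp_all add: scott_open_def binder_defs directed_sup_syntax)

lemma apart_syntax:
  "name_bound (x \<^bold>\<sharp> y) = 5"
  "5 \<le> n \<Longrightarrow> inst1 n a (x \<^bold>\<sharp> y) = (put n a x \<^bold>\<sharp> put n a y)"
  "5 \<le> n \<Longrightarrow> inst2 n A (x \<^bold>\<sharp> y) = (x \<^bold>\<sharp> y)"
  by (simp_all add: apart_def binder_defs directed_sup_syntax scott_open_syntax)

lemmas domain_syntax = directed_sup_syntax way_below_syntax scott_open_syntax apart_syntax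

lemmas substitutive_simps = substitutive1_def substitutive2_def binder_defs domain_syntax

text \<open>Since forcing is monotone, consecutive universal quantifiers and implications need only one
  passage to a larger context.\<close>

lemma forall_points_flatten:
  "(\<forall>d\<ge>c. \<forall>a\<in>pts d. \<forall>e\<ge>d. P e a) \<longleftrightarrow> (\<forall>d\<ge>c. \<forall>a\<in>pts d. P d a)"
  by (meson order_refl order_trans pts_up)

lemma forall_sets_flatten:
  "(\<forall>d\<ge>c. \<forall>A::nat. \<forall>e\<ge>d. P e A) \<longleftrightarrow> (\<forall>d\<ge>(c::ctx). \<forall>A. P d A)"
  by (meson order_refl order_trans)

lemma imp_flatten:
  "(\<forall>d\<ge>c. (d \<tturnstile> p) \<longrightarrow> (\<forall>e\<ge>d. P e)) \<longleftrightarrow> (\<forall>d\<ge>c. (d \<tturnstile> p) \<longrightarrow> P d)"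
  by (meson order_refl order_trans forces_mono)

lemma imp_conj_flatten:
  "(\<forall>d\<ge>c. (d \<tturnstile> p) \<and> (d \<tturnstile> q) \<longrightarrow> (\<forall>e\<ge>d. P e)) \<longleftrightarrow> (\<forall>d\<ge>c. (d \<tturnstile> p) \<and> (d \<tturnstile> q) \<longrightarrow> P d)"
  using imp_flatten[of c "p \<^bold>\<and> q" P] by (simp add: forces_And)

lemmas forces_simps = forces_Forall1 forces_Forall2 forces_And forces_Imp
  forall_points_flatten forall_sets_flatten imp_flatten imp_conj_flatten binder_defs domain_syntax

section \<open>Pointwise readings of the order-theoretic notions\<close>

lemma forces_poset:
  "(c \<tturnstile> poset) \<longleftrightarrow> (\<forall>d\<ge>c. \<forall>x\<in>pts d. d \<tturnstile> Par x \<^bold>\<sqsubseteq> Par x) \<and>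
    (\<forall>d\<ge>c. \<forall>x\<in>pts d. \<forall>y\<in>pts d. \<forall>z\<in>pts d.
      (d \<tturnstile> Par x \<^bold>\<sqsubseteq> Par y) \<longrightarrow> (d \<tturnstile> Par y \<^bold>\<sqsubseteq> Par z) \<longrightarrow> (d \<tturnstile> Par x \<^bold>\<sqsubseteq> Par z)) \<and>
    (\<forall>d\<ge>c. \<forall>x\<in>pts d. \<forall>y\<in>pts d.
      (d \<tturnstile> Par x \<^bold>\<sqsubseteq> Par y) \<longrightarrow> (d \<tturnstile> Par y \<^bold>\<sqsubseteq> Par x) \<longrightarrow> (d \<tturnstile> Par x \<^bold>= Par y))"
  by (simp add: poset_def forces_simps)

text \<open>The existential parts stay formulas: forcing them need not produce a witness in the same
  context.\<close>

lemma forces_directed: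
  "(c \<tturnstile> directed (mem S)) \<longleftrightarrow> (c \<tturnstile> (\<^bold>\<exists>x. mem S x)) \<and>
    (\<forall>d\<ge>c. \<forall>x\<in>pts d. \<forall>y\<in>pts d. (d \<tturnstile> mem S (Par x)) \<longrightarrow> (d \<tturnstile> mem S (Par y)) \<longrightarrow>
      (d \<tturnstile> (\<^bold>\<exists>z. mem S z \<^bold>\<and> Par x \<^bold>\<sqsubseteq> z \<^bold>\<and> Par y \<^bold>\<sqsubseteq> z)))"
  by (simp add: directed_def forces_simps)

lemma forces_is_sup:
  "u \<in> pts c \<Longrightarrow> (c \<tturnstile> is_sup (mem S) (Par u)) \<longleftrightarrow>
    (\<forall>d\<ge>c. \<forall>x\<in>pts d. (d \<tturnstile> mem S (Par x)) \<longrightarrow> (d \<tturnstile> Par x \<^bold>\<sqsubseteq> Par u)) \<and>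
    (\<forall>d\<ge>c. \<forall>v\<in>pts d. (\<forall>e\<ge>d. \<forall>x\<in>pts e. (e \<tturnstile> mem S (Par x)) \<longrightarrow> (e \<tturnstile> Par x \<^bold>\<sqsubseteq> Par v))
      \<longrightarrow> (d \<tturnstile> Par u \<^bold>\<sqsubseteq> Par v))"
  by (simp add: is_sup_def forces_simps)

lemma forces_way_below:
  "(c \<tturnstile> Par x \<^bold>\<lless> Par y) \<longleftrightarrow>
    (\<forall>d\<ge>c. \<forall>S. (d \<tturnstile> directed (mem S)) \<longrightarrow> (\<forall>u\<in>pts d. (d \<tturnstile> is_sup (mem S) (Par u)) \<longrightarrow>
      (d \<tturnstile> Par y \<^bold>\<sqsubseteq> Par u) \<longrightarrow> (d \<tturnstile> (\<^bold>\<exists>s. mem S s \<^bold>\<and> Par x \<^bold>\<sqsubseteq> s))))"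
  by (simp add: way_below_def forces_simps)

lemma forces_scott_open:
  "(c \<tturnstile> scott_open (mem U)) \<longleftrightarrow>
    (\<forall>d\<ge>c. \<forall>x\<in>pts d. \<forall>y\<in>pts d. (d \<tturnstile> mem U (Par x)) \<longrightarrow> (d \<tturnstile> Par x \<^bold>\<sqsubseteq> Par y)
      \<longrightarrow> (d \<tturnstile> mem U (Par y))) \<and>
    (\<forall>d\<ge>c. \<forall>S. (d \<tturnstile> directed (mem S)) \<longrightarrow> (\<forall>u\<in>pts d. (d \<tturnstile> is_sup (mem S) (Par u)) \<longrightarrow>
      (d \<tturnstile> mem U (Par u)) \<longrightarrow> (d \<tturnstile> (\<^bold>\<exists>s. mem S s \<^bold>\<and> mem U s))))"
  by (simp add: scott_open_def forces_simps)

text \<open>The set of basis elements way below \<open>x\<close> is given by a formula and not by a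
  set parameter, so its directedness and supremum are written out instead of being obtained from
  \<open>forces_directed\<close> and \<open>forces_is_sup\<close>.\<close>

lemma forces_dcpo_basis:
  "(c \<tturnstile> dcpo_basis (mem B)) \<longleftrightarrow>
    (\<forall>d\<ge>c. \<forall>x\<in>pts d. (d \<tturnstile> (\<^bold>\<exists>b. mem B b \<^bold>\<and> b \<^bold>\<lless> Par x)) \<and>
      (\<forall>e\<ge>d. \<forall>b\<in>pts e. \<forall>b'\<in>pts e. (e \<tturnstile> mem B (Par b)) \<and> (e \<tturnstile> Par b \<^bold>\<lless> Par x) \<longrightarrow>
        (e \<tturnstile> mem B (Par b')) \<and> (e \<tturnstile> Par b' \<^bold>\<lless> Par x) \<longrightarrow>
        (e \<tturnstile> (\<^bold>\<exists>z. (mem B z \<^bold>\<and> z \<^bold>\<lless> Par x) \<^bold>\<and> Par b \<^bold>\<sqsubseteq> z \<^bold>\<and> Par b' \<^bold>\<sqsubseteq> z))) \<and>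
      (\<forall>e\<ge>d. \<forall>b\<in>pts e. (e \<tturnstile> mem B (Par b)) \<and> (e \<tturnstile> Par b \<^bold>\<lless> Par x) \<longrightarrow> (e \<tturnstile> Par b \<^bold>\<sqsubseteq> Par x)) \<and>
      (\<forall>e\<ge>d. \<forall>v\<in>pts e. (\<forall>f\<ge>e. \<forall>b\<in>pts f. (f \<tturnstile> mem B (Par b)) \<and> (f \<tturnstile> Par b \<^bold>\<lless> Par x) \<longrightarrow> (f \<tturnstile> Par b \<^bold>\<sqsubseteq> Par v))
        \<longrightarrow> (e \<tturnstile> Par x \<^bold>\<sqsubseteq> Par v)))"
  by (simp add: dcpo_basis_def directed_def is_sup_def forces_simps)

section \<open>Interpolation and the basic open sets\<close>

lemma way_belowE:
  assumes "c \<tturnstile> Par x \<^bold>\<lless> Par y" "c \<tturnstile> directed (mem S)" "u \<in> pts c" "c \<tturnstile> is_sup (mem S) (Par u)"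
    "c \<tturnstile> Par y \<^bold>\<sqsubseteq> Par u"
    and r: "\<And>d s. \<lbrakk>c \<le> d; s \<in> pts d; d \<tturnstile> mem S (Par s); d \<tturnstile> Par x \<^bold>\<sqsubseteq> Par s\<rbrakk> \<Longrightarrow> d \<tturnstile> r"
  shows "c \<tturnstile> r"
proof -
  have "c \<tturnstile> (\<^bold>\<exists>s. mem S s \<^bold>\<and> Par x \<^bold>\<sqsubseteq> s)"
    using assms(1-5) unfolding forces_way_below by blast
  then show ?thesis
    by (rule forces_ex1E) (use r in \<open>simp_all add: forces_And substitutive_simps\<close>)
qed

lemma scott_openE:
  assumes "c \<tturnstile> scott_open (mem U)" "c \<tturnstile> directed (mem S)" "u \<in> pts c" "c \<tturnstile> is_sup (mem S) (Par u)"
    "c \<tturnstile> mem U (Par u)"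
    and r: "\<And>d s. \<lbrakk>c \<le> d; s \<in> pts d; d \<tturnstile> mem S (Par s); d \<tturnstile> mem U (Par s)\<rbrakk> \<Longrightarrow> d \<tturnstile> r"
  shows "c \<tturnstile> r"
proof -
  have "c \<tturnstile> (\<^bold>\<exists>s. mem S s \<^bold>\<and> mem U s)"
    using assms(1-5) unfolding forces_scott_open by blast
  then show ?thesis
    by (rule forces_ex1E) (use r in \<open>simp_all add: forces_And substitutive_simps\<close>)
qed

lemma scott_open_upper:
  assumes "c \<tturnstile> scott_open (mem U)" "x \<in> pts c" "y \<in> pts c"
    "c \<tturnstile> mem U (Par x)" "c \<tturnstile> Par x \<^bold>\<sqsubseteq> Par y"
  shows "c \<tturnstile> mem U (Par y)"
  using assms unfolding forces_scott_open by blast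

lemma directedI:
  assumes "c \<tturnstile> (\<^bold>\<exists>x. mem S x)"
    and "\<And>d x y. \<lbrakk>c \<le> d; x \<in> pts d; y \<in> pts d; d \<tturnstile> mem S (Par x); d \<tturnstile> mem S (Par y)\<rbrakk>
      \<Longrightarrow> d \<tturnstile> (\<^bold>\<exists>z. mem S z \<^bold>\<and> Par x \<^bold>\<sqsubseteq> z \<^bold>\<and> Par y \<^bold>\<sqsubseteq> z)"
  shows "c \<tturnstile> directed (mem S)"
  using assms unfolding forces_directed by blast

lemma inhabitedI:
  assumes "c \<tturnstile> mem S (Par a)" "a \<in> pts c"
  shows "c \<tturnstile> (\<^bold>\<exists>x. mem S x)"
  by (rule forces_ex1I[of _ _ a]) (use assms in \<open>simp_all add: substitutive_simps\<close>)

lemma upper_boundI: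
  assumes "c \<tturnstile> mem S (Par z)" "c \<tturnstile> Par x \<^bold>\<sqsubseteq> Par z" "c \<tturnstile> Par y \<^bold>\<sqsubseteq> Par z" "z \<in> pts c"
  shows "c \<tturnstile> (\<^bold>\<exists>z. mem S z \<^bold>\<and> Par x \<^bold>\<sqsubseteq> z \<^bold>\<and> Par y \<^bold>\<sqsubseteq> z)"
  by (rule forces_ex1I[of _ _ z]) (use assms in \<open>simp_all add: forces_And substitutive_simps\<close>)

section \<open>The order and the way-below relation\<close>

lemma poset_refl: "c \<tturnstile> poset \<Longrightarrow> x \<in> pts c \<Longrightarrow> c \<tturnstile> Par x \<^bold>\<sqsubseteq> Par x"
  unfolding forces_poset by blast

lemma poset_trans:
  "\<lbrakk>c \<tturnstile> poset; c \<tturnstile> Par x \<^bold>\<sqsubseteq> Par y; c \<tturnstile> Par y \<^bold>\<sqsubseteq> Par z; x \<in> pts c; y \<in> pts c; z \<in> pts c\<rbrakk>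
    \<Longrightarrow> c \<tturnstile> Par x \<^bold>\<sqsubseteq> Par z"
  unfolding forces_poset by blast

text \<open>The relation is tested on the lower set of \<open>y\<close>. As \<open>y\<close> belongs
  to it, this set is directed with supremum \<open>y\<close>, and the element \<open>s\<close>
  obtained satisfies \<open>x \<sqsubseteq> s\<close> and \<open>s \<sqsubseteq> y\<close>.\<close>

lemma way_below_imp_le:
  assumes "c \<tturnstile> poset" "x \<in> pts c" "y \<in> pts c" "c \<tturnstile> Par x \<^bold>\<lless> Par y"
  shows "c \<tturnstile> Par x \<^bold>\<sqsubseteq> Par y"
proof (rule comprehension[of "\<lambda>z. z \<^bold>\<sqsubseteq> Par y"])
  fix d S assume d: "c \<le> d"
    and S: "\<And>e a. d \<le> e \<Longrightarrow> a \<in> pts e \<Longrightarrow> (e \<tturnstile> mem S (Par a)) \<longleftrightarrow> (e \<tturnstile> Par a \<^bold>\<sqsubseteq> Par y)"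
  note c = assms(1,4)[THEN forces_mono, OF d] assms(2,3)[THEN pts_up, OF d]
  have y: "d \<tturnstile> mem S (Par y)" using S c poset_refl by blast
  have "d \<tturnstile> directed (mem S)"
  proof (rule directedI)
    fix e u v assume e: "d \<le> e" "u \<in> pts e" "v \<in> pts e" "e \<tturnstile> mem S (Par u)" "e \<tturnstile> mem S (Par v)"
    then have "e \<tturnstile> Par u \<^bold>\<sqsubseteq> Par y" "e \<tturnstile> Par v \<^bold>\<sqsubseteq> Par y" using S by auto
    then show "e \<tturnstile> (\<^bold>\<exists>z. mem S z \<^bold>\<and> Par u \<^bold>\<sqsubseteq> z \<^bold>\<and> Par v \<^bold>\<sqsubseteq> z)"
      using forces_mono[OF y e(1)] pts_up[OF c(4) e(1)] by (blast intro: upper_boundI)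
  qed (rule inhabitedI[OF y c(4)])
  moreover have "d \<tturnstile> is_sup (mem S) (Par y)"
    unfolding forces_is_sup[OF c(4)]
    using S y c(4) by (meson order_refl pts_up forces_mono)
  ultimately show "d \<tturnstile> Par x \<^bold>\<sqsubseteq> Par y"
  proof (rule way_belowE[OF c(2) _ c(4)])
    show "d \<tturnstile> Par y \<^bold>\<sqsubseteq> Par y" using c poset_refl by blast
    fix e s assume e: "d \<le> e" "s \<in> pts e" "e \<tturnstile> mem S (Par s)" "e \<tturnstile> Par x \<^bold>\<sqsubseteq> Par s"
    then have "e \<tturnstile> Par s \<^bold>\<sqsubseteq> Par y" using S by auto
    then show "e \<tturnstile> Par x \<^bold>\<sqsubseteq> Par y"
      using poset_trans c(1,2)[THEN forces_mono, OF e(1)] c(3,4)[THEN pts_up, OF e(1)] e by blast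
  qed
qed (simp_all add: substitutive_simps)

text \<open>A directed set with supremum above \<open>y'\<close> also has its supremum above
  \<open>y\<close>; the element above \<open>x\<close> that it then contains is above
  \<open>x'\<close>.\<close>

lemma way_below_mono:
  assumes "c \<tturnstile> poset" "c \<tturnstile> Par x' \<^bold>\<sqsubseteq> Par x" "c \<tturnstile> Par x \<^bold>\<lless> Par y" "c \<tturnstile> Par y \<^bold>\<sqsubseteq> Par y'"
    "x' \<in> pts c" "x \<in> pts c" "y \<in> pts c" "y' \<in> pts c"
  shows "c \<tturnstile> Par x' \<^bold>\<lless> Par y'"
  unfolding forces_way_below
proof (intro allI impI ballI)
  fix d S u assume d: "c \<le> d" and S: "d \<tturnstile> directed (mem S)"
    and u: "u \<in> pts d" "d \<tturnstile> is_sup (mem S) (Par u)" "d \<tturnstile> Par y' \<^bold>\<sqsubseteq> Par u"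
  note c = assms(1-4)[THEN forces_mono, OF d] assms(5-8)[THEN pts_up, OF d]
  have "d \<tturnstile> Par y \<^bold>\<sqsubseteq> Par u" using poset_trans c u by blast
  with c(3) S u(1,2) show "d \<tturnstile> (\<^bold>\<exists>s. mem S s \<^bold>\<and> Par x' \<^bold>\<sqsubseteq> s)"
  proof (rule way_belowE)
    fix e s assume e: "d \<le> e" "s \<in> pts e" "e \<tturnstile> mem S (Par s)" "e \<tturnstile> Par x \<^bold>\<sqsubseteq> Par s"
    then have "e \<tturnstile> Par x' \<^bold>\<sqsubseteq> Par s"
      using poset_trans c(1,2)[THEN forces_mono, OF e(1)] c(5,6)[THEN pts_up, OF e(1)] by blast
    with e show "e \<tturnstile> (\<^bold>\<exists>s. mem S s \<^bold>\<and> Par x' \<^bold>\<sqsubseteq> s)"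
      by (intro forces_ex1I[of _ _ s]) (simp_all add: forces_And substitutive_simps)
  qed
qed

section \<open>Approximation by basis elements\<close>

definition based :: "ctx \<Rightarrow> nat \<Rightarrow> bool"
  where "based c B \<longleftrightarrow> (c \<tturnstile> poset) \<and> (c \<tturnstile> dcpo_basis (mem B))"

lemma based_up: "based c B \<Longrightarrow> c \<le> d \<Longrightarrow> based d B"
  unfolding based_def using forces_mono by blast

lemma based_poset: "based c B \<Longrightarrow> c \<tturnstile> poset"
  unfolding based_def by blast

lemma basis_inhabitedE:
  assumes "based c B" "x \<in> pts c"
    and r: "\<And>d b. \<lbrakk>c \<le> d; b \<in> pts d; d \<tturnstile> mem B (Par b); d \<tturnstile> Par b \<^bold>\<lless> Par x\<rbrakk> \<Longrightarrow> d \<tturnstile> r"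
  shows "c \<tturnstile> r"
proof -
  have "c \<tturnstile> (\<^bold>\<exists>b. mem B b \<^bold>\<and> b \<^bold>\<lless> Par x)"
    using assms(1,2) unfolding based_def forces_dcpo_basis by blast
  then show ?thesis
    by (rule forces_ex1E) (use r in \<open>simp_all add: forces_And substitutive_simps\<close>)
qed

lemma basis_upper_boundE:
  assumes "based c B" "x \<in> pts c" "b \<in> pts c" "b' \<in> pts c"
    "c \<tturnstile> mem B (Par b)" "c \<tturnstile> Par b \<^bold>\<lless> Par x" "c \<tturnstile> mem B (Par b')" "c \<tturnstile> Par b' \<^bold>\<lless> Par x"
    and r: "\<And>d z. \<lbrakk>c \<le> d; z \<in> pts d; d \<tturnstile> mem B (Par z); d \<tturnstile> Par z \<^bold>\<lless> Par x;
      d \<tturnstile> Par b \<^bold>\<sqsubseteq> Par z; d \<tturnstile> Par b' \<^bold>\<sqsubseteq> Par z\<rbrakk> \<Longrightarrow> d \<tturnstile> r"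
  shows "c \<tturnstile> r"
proof -
  have "c \<tturnstile> (\<^bold>\<exists>z. (mem B z \<^bold>\<and> z \<^bold>\<lless> Par x) \<^bold>\<and> Par b \<^bold>\<sqsubseteq> z \<^bold>\<and> Par b' \<^bold>\<sqsubseteq> z)"
    using assms(1-8) unfolding based_def forces_dcpo_basis by blast
  then show ?thesis
    by (rule forces_ex1E) (use r in \<open>simp_all add: forces_And substitutive_simps\<close>)
qed

text \<open>As \<open>x\<close> is the least upper bound of the basis elements way below it, an
  inequality from \<open>x\<close> can be tested on those.\<close>

lemma basis_leI:
  assumes "based c B" "x \<in> pts c" "v \<in> pts c"
    and "\<And>d b. \<lbrakk>c \<le> d; b \<in> pts d; d \<tturnstile> mem B (Par b); d \<tturnstile> Par b \<^bold>\<lless> Par x\<rbrakk> \<Longrightarrow> d \<tturnstile> Par b \<^bold>\<sqsubseteq> Par v"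
  shows "c \<tturnstile> Par x \<^bold>\<sqsubseteq> Par v"
  using assms unfolding based_def forces_dcpo_basis by blast

text \<open>The forcing clauses of the way-below relation and of Scott openness range over set
  parameters. Comprehension turns the basis elements way below \<open>x\<close> into such a
  parameter, so that these clauses can be applied to it.\<close>

lemma approximantsE:
  assumes "based c B" "x \<in> pts c"
    and r: "\<And>d S. \<lbrakk>c \<le> d; d \<tturnstile> directed (mem S); d \<tturnstile> is_sup (mem S) (Par x);
      \<And>e a. d \<le> e \<Longrightarrow> a \<in> pts e \<Longrightarrow> (e \<tturnstile> mem S (Par a)) \<longleftrightarrow> (e \<tturnstile> mem B (Par a)) \<and> (e \<tturnstile> Par a \<^bold>\<lless> Par x)\<rbrakk>
      \<Longrightarrow> d \<tturnstile> r"
  shows "c \<tturnstile> r"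
proof (rule comprehension[of "\<lambda>b. mem B b \<^bold>\<and> b \<^bold>\<lless> Par x"])
  fix d S assume d: "c \<le> d"
    and "\<And>e a. d \<le> e \<Longrightarrow> a \<in> pts e \<Longrightarrow> (e \<tturnstile> mem S (Par a)) \<longleftrightarrow> (e \<tturnstile> mem B (Par a) \<^bold>\<and> Par a \<^bold>\<lless> Par x)"
  then have S: "(e \<tturnstile> mem S (Par a)) \<longleftrightarrow> (e \<tturnstile> mem B (Par a)) \<and> (e \<tturnstile> Par a \<^bold>\<lless> Par x)"
    if "d \<le> e" "a \<in> pts e" for e a using that by (simp add: forces_And)
  have x: "x \<in> pts d" and B: "based d B" using assms(1,2) d pts_up based_up by auto
  have "d \<tturnstile> directed (mem S)"
  proof (rule directedI)
    show "d \<tturnstile> (\<^bold>\<exists>x. mem S x)"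
      using B x by (rule basis_inhabitedE) (use S in \<open>blast intro: inhabitedI\<close>)
    fix e y z assume e: "d \<le> e" "y \<in> pts e" "z \<in> pts e" "e \<tturnstile> mem S (Par y)" "e \<tturnstile> mem S (Par z)"
    show "e \<tturnstile> (\<^bold>\<exists>w. mem S w \<^bold>\<and> Par y \<^bold>\<sqsubseteq> w \<^bold>\<and> Par z \<^bold>\<sqsubseteq> w)"
    proof (rule basis_upper_boundE[of e B x y z])
      fix f w assume "e \<le> f" "w \<in> pts f" "f \<tturnstile> mem B (Par w)" "f \<tturnstile> Par w \<^bold>\<lless> Par x"
        "f \<tturnstile> Par y \<^bold>\<sqsubseteq> Par w" "f \<tturnstile> Par z \<^bold>\<sqsubseteq> Par w"
      then show "f \<tturnstile> (\<^bold>\<exists>w. mem S w \<^bold>\<and> Par y \<^bold>\<sqsubseteq> w \<^bold>\<and> Par z \<^bold>\<sqsubseteq> w)"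
        using S e(1) order_trans by (blast intro: upper_boundI)
    qed (use e S B x based_up pts_up in blast)+
  qed
  moreover have "d \<tturnstile> is_sup (mem S) (Par x)"
    unfolding forces_is_sup[OF x]
  proof (intro conjI allI impI ballI)
    fix e a assume "d \<le> e" "a \<in> pts e" "e \<tturnstile> mem S (Par a)"
    then show "e \<tturnstile> Par a \<^bold>\<sqsubseteq> Par x"
      using S B x based_up pts_up based_poset way_below_imp_le by blast
  next
    fix e v assume e: "d \<le> e" "v \<in> pts e"
      and v: "\<forall>f\<ge>e. \<forall>a\<in>pts f. (f \<tturnstile> mem S (Par a)) \<longrightarrow> (f \<tturnstile> Par a \<^bold>\<sqsubseteq> Par v)"
    show "e \<tturnstile> Par x \<^bold>\<sqsubseteq> Par v"
      by (rule basis_leI[OF based_up[OF B] pts_up[OF x]]) (use e S v order_trans in blast)+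
  qed
  ultimately show "d \<tturnstile> r" using r d S by blast
qed (simp_all add: substitutive_simps way_below_syntax)

text \<open>Let \<open>S\<close> consist of the basis elements \<open>z\<close> with
  \<open>z \<lless> b \<lless> y\<close> for some basis element \<open>b\<close>. It is directed
  with supremum \<open>y\<close>, so \<open>x \<lless> y\<close> yields a member \<open>z\<close>
  above \<open>x\<close>, and its \<open>b\<close> is the interpolant.\<close>

lemma interpolationE:
  assumes "based c B" "x \<in> pts c" "y \<in> pts c" "c \<tturnstile> Par x \<^bold>\<lless> Par y"
    and r: "\<And>d b. \<lbrakk>c \<le> d; b \<in> pts d; d \<tturnstile> mem B (Par b); d \<tturnstile> Par x \<^bold>\<lless> Par b; d \<tturnstile> Par b \<^bold>\<lless> Par y\<rbrakk>
      \<Longrightarrow> d \<tturnstile> r"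
  shows "c \<tturnstile> r"
\<comment> \<open>Requiring \<open>z\<close> itself to lie in the basis allows two members to be
  bounded inside the approximants of a common element.\<close>
proof (rule comprehension[of "\<lambda>z. \<^bold>\<exists>b. mem B z \<^bold>\<and> mem B b \<^bold>\<and> z \<^bold>\<lless> b \<^bold>\<and> b \<^bold>\<lless> Par y"])
  fix d S assume d: "c \<le> d"
    and S: "\<And>e z. d \<le> e \<Longrightarrow> z \<in> pts e \<Longrightarrow> (e \<tturnstile> mem S (Par z)) \<longleftrightarrow>
      (e \<tturnstile> (\<^bold>\<exists>b. mem B (Par z) \<^bold>\<and> mem B b \<^bold>\<and> Par z \<^bold>\<lless> b \<^bold>\<and> b \<^bold>\<lless> Par y))"
  have SI: "e \<tturnstile> mem S (Par z)"
    if "d \<le> e" "z \<in> pts e" "b \<in> pts e" "e \<tturnstile> mem B (Par z)" "e \<tturnstile> mem B (Par b)"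
      "e \<tturnstile> Par z \<^bold>\<lless> Par b" "e \<tturnstile> Par b \<^bold>\<lless> Par y" for e z b
    unfolding S[OF that(1,2)]
    by (rule forces_ex1I[of _ _ b]) (use that in \<open>simp_all add: forces_And substitutive_simps\<close>)
  have SE: "e \<tturnstile> q"
    if "e \<tturnstile> mem S (Par z)" "d \<le> e" "z \<in> pts e"
      and q: "\<And>f b. \<lbrakk>e \<le> f; b \<in> pts f; f \<tturnstile> mem B (Par z); f \<tturnstile> mem B (Par b); f \<tturnstile> Par z \<^bold>\<lless> Par b;
        f \<tturnstile> Par b \<^bold>\<lless> Par y\<rbrakk> \<Longrightarrow> f \<tturnstile> q" for e z q
    using that(1) unfolding S[OF that(2,3)]
    by (rule forces_ex1E) (use q in \<open>simp_all add: forces_And substitutive_simps\<close>)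
  note B = based_up[OF assms(1) d] and x = pts_up[OF assms(2) d] and y = pts_up[OF assms(3) d]
  note P = based_poset[OF B]
  have "d \<tturnstile> directed (mem S)"
  proof (rule directedI)
    \<comment> \<open>Approximating twice, \<open>y\<close> by \<open>b\<close> and then
      \<open>b\<close> by \<open>z\<close>, gives a member of \<open>S\<close>.\<close>
    show "d \<tturnstile> (\<^bold>\<exists>z. mem S z)"
      using B y
    proof (rule basis_inhabitedE)
      fix e b assume e: "d \<le> e" and b: "b \<in> pts e" "e \<tturnstile> mem B (Par b)" "e \<tturnstile> Par b \<^bold>\<lless> Par y"
      show "e \<tturnstile> (\<^bold>\<exists>z. mem S z)"
        using based_up[OF B e] b(1)
      proof (rule basis_inhabitedE)
        fix f z assume f: "e \<le> f" and "z \<in> pts f" "f \<tturnstile> mem B (Par z)" "f \<tturnstile> Par z \<^bold>\<lless> Par b"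
        then show "f \<tturnstile> (\<^bold>\<exists>z. mem S z)"
          using inhabitedI SI[OF order_trans[OF e f]] b(2,3)[THEN forces_mono, OF f] pts_up[OF b(1) f] by blast
      qed
    qed
    fix e z z' assume e: "d \<le> e" "z \<in> pts e" "z' \<in> pts e" "e \<tturnstile> mem S (Par z)" "e \<tturnstile> mem S (Par z')"
    let ?r = "\<^bold>\<exists>w. mem S w \<^bold>\<and> Par z \<^bold>\<sqsubseteq> w \<^bold>\<and> Par z' \<^bold>\<sqsubseteq> w"
    show "e \<tturnstile> ?r"
      using e(4,1,2)
    proof (rule SE)
      fix f b assume f: "e \<le> f" and b: "b \<in> pts f" "f \<tturnstile> mem B (Par z)" "f \<tturnstile> mem B (Par b)"
        "f \<tturnstile> Par z \<^bold>\<lless> Par b" "f \<tturnstile> Par b \<^bold>\<lless> Par y"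
      show "f \<tturnstile> ?r"
        using forces_mono[OF e(5) f] order_trans[OF e(1) f] pts_up[OF e(3) f]
      proof (rule SE)
        fix g b' assume g: "f \<le> g" and b': "b' \<in> pts g" "g \<tturnstile> mem B (Par z')" "g \<tturnstile> mem B (Par b')"
          "g \<tturnstile> Par z' \<^bold>\<lless> Par b'" "g \<tturnstile> Par b' \<^bold>\<lless> Par y"
        note dg = order_trans[OF order_trans[OF e(1) f] g]
        note b = b(2-5)[THEN forces_mono, OF g] b(1)[THEN pts_up, OF g]
        \<comment> \<open>First \<open>b\<close> and \<open>b'\<close> have an upper bound
          \<open>w \<lless> y\<close> in the basis. Then \<open>z\<close> and \<open>z'\<close> are
          way below \<open>w\<close>, so they have an upper bound \<open>v \<lless> w\<close> in the
          basis, and \<open>w\<close> witnesses that \<open>v\<close> is in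
          \<open>S\<close>.\<close>
        show "g \<tturnstile> ?r"
          using based_up[OF B dg] pts_up[OF y dg] b(5) b'(1) b(2,4) b'(3,5)
        proof (rule basis_upper_boundE)
          fix h w assume h: "g \<le> h" and w: "w \<in> pts h" "h \<tturnstile> mem B (Par w)" "h \<tturnstile> Par w \<^bold>\<lless> Par y"
            "h \<tturnstile> Par b \<^bold>\<sqsubseteq> Par w" "h \<tturnstile> Par b' \<^bold>\<sqsubseteq> Par w"
          note dh = order_trans[OF dg h]
          note zs = e(2,3)[THEN pts_up, OF f, THEN pts_up, OF g, THEN pts_up, OF h]
          note b = b(1-4)[THEN forces_mono, OF h] b(5)[THEN pts_up, OF h]
          note b' = b'(2-5)[THEN forces_mono, OF h] b'(1)[THEN pts_up, OF h]
          note Ph = forces_mono[OF P dh]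
          have zw: "h \<tturnstile> Par z \<^bold>\<lless> Par w" "h \<tturnstile> Par z' \<^bold>\<lless> Par w"
            using way_below_mono[OF Ph] poset_refl[OF Ph] zs b b' w by blast+
          show "h \<tturnstile> ?r"
            using based_up[OF B dh] w(1) zs b(1) zw(1) b'(1) zw(2)
          proof (rule basis_upper_boundE)
            fix k v assume k: "h \<le> k" and v: "v \<in> pts k" "k \<tturnstile> mem B (Par v)" "k \<tturnstile> Par v \<^bold>\<lless> Par w"
              "k \<tturnstile> Par z \<^bold>\<sqsubseteq> Par v" "k \<tturnstile> Par z' \<^bold>\<sqsubseteq> Par v"
            have "k \<tturnstile> mem S (Par v)"
              using SI[OF order_trans[OF dh k] v(1) pts_up[OF w(1) k] v(2)] w(2,3)[THEN forces_mono, OF k] v(3)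
              by blast
            then show "k \<tturnstile> ?r" using v by (blast intro: upper_boundI)
          qed
        qed
      qed
    qed
  qed
  moreover have "d \<tturnstile> is_sup (mem S) (Par y)"
    unfolding forces_is_sup[OF y]
  proof (intro conjI allI impI ballI)
    fix e z assume e: "d \<le> e" "z \<in> pts e" "e \<tturnstile> mem S (Par z)"
    show "e \<tturnstile> Par z \<^bold>\<sqsubseteq> Par y"
      using e(3,1,2)
    proof (rule SE)
      fix f b assume f: "e \<le> f" and b: "b \<in> pts f" "f \<tturnstile> Par z \<^bold>\<lless> Par b" "f \<tturnstile> Par b \<^bold>\<lless> Par y"
      note df = order_trans[OF e(1) f]
      show "f \<tturnstile> Par z \<^bold>\<sqsubseteq> Par y"
        using poset_trans[OF forces_mono[OF P df]] way_below_imp_le[OF forces_mono[OF P df]] b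
          pts_up[OF e(2) f] pts_up[OF y df] by blast
    qed
  next
    fix e v assume e: "d \<le> e" "v \<in> pts e"
      and v: "\<forall>f\<ge>e. \<forall>z\<in>pts f. (f \<tturnstile> mem S (Par z)) \<longrightarrow> (f \<tturnstile> Par z \<^bold>\<sqsubseteq> Par v)"
    \<comment> \<open>The inequality is tested on the approximants \<open>b\<close> of
      \<open>y\<close>, and for each of these on the approximants \<open>z\<close> of
      \<open>b\<close>; every such \<open>z\<close> is in \<open>S\<close>, hence below
      \<open>v\<close>.\<close>
    show "e \<tturnstile> Par y \<^bold>\<sqsubseteq> Par v"
      using based_up[OF B e(1)] pts_up[OF y e(1)] e(2)
    proof (rule basis_leI)
      fix f b assume f: "e \<le> f" and b: "b \<in> pts f" "f \<tturnstile> mem B (Par b)" "f \<tturnstile> Par b \<^bold>\<lless> Par y"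
      note df = order_trans[OF e(1) f]
      show "f \<tturnstile> Par b \<^bold>\<sqsubseteq> Par v"
        using based_up[OF B df] b(1) pts_up[OF e(2) f]
      proof (rule basis_leI)
        fix g z assume g: "f \<le> g" and z: "z \<in> pts g" "g \<tturnstile> mem B (Par z)" "g \<tturnstile> Par z \<^bold>\<lless> Par b"
        have "g \<tturnstile> mem S (Par z)"
          using SI[OF order_trans[OF df g] z(1) pts_up[OF b(1) g] z(2)] b(2,3)[THEN forces_mono, OF g] z(3)
          by blast
        then show "g \<tturnstile> Par z \<^bold>\<sqsubseteq> Par v" using v order_trans[OF f g] z(1) by blast
      qed
    qed
  qed
  \<comment> \<open>The relation \<open>x \<lless> y\<close> is now applied to \<open>S\<close>,
    whose supremum is \<open>y\<close>.\<close>
  ultimately show "d \<tturnstile> r"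
    using forces_mono[OF assms(4) d] y poset_refl[OF P y]
  proof (elim way_belowE[of d x y S y])
    fix e z assume e: "d \<le> e" and z: "z \<in> pts e" "e \<tturnstile> mem S (Par z)" "e \<tturnstile> Par x \<^bold>\<sqsubseteq> Par z"
    show "e \<tturnstile> r"
      using z(2) e z(1)
    proof (rule SE)
      fix f b assume f: "e \<le> f" and b: "b \<in> pts f" "f \<tturnstile> mem B (Par b)" "f \<tturnstile> Par z \<^bold>\<lless> Par b"
        "f \<tturnstile> Par b \<^bold>\<lless> Par y"
      note df = order_trans[OF e f] note Pf = forces_mono[OF P df]
      have "f \<tturnstile> Par x \<^bold>\<lless> Par b"
        using way_below_mono[OF Pf forces_mono[OF z(3) f] b(3) poset_refl[OF Pf b(1)]] pts_up[OF x df]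
          pts_up[OF z(1) f] b(1) by blast
      then show "f \<tturnstile> r" using r[OF order_trans[OF d df]] b by blast
    qed
  qed
qed (simp_all add: substitutive_simps way_below_syntax ex1_def)

text \<open>If \<open>b \<lless> u\<close> and \<open>u\<close> is the supremum of \<open>S\<close>,
  the relation alone only gives a member of \<open>S\<close> above \<open>b\<close>. With an
  interpolant \<open>b \<lless> a \<lless> u\<close> there is a member \<open>s\<close> above
  \<open>a\<close>, and then \<open>b \<lless> s\<close>.\<close>

lemma way_above_scott_open:
  assumes "based c B" "b \<in> pts c"
    and V: "\<And>d a. c \<le> d \<Longrightarrow> a \<in> pts d \<Longrightarrow> (d \<tturnstile> mem V (Par a)) \<longleftrightarrow> (d \<tturnstile> Par b \<^bold>\<lless> Par a)"
  shows "c \<tturnstile> scott_open (mem V)"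
  unfolding forces_scott_open
proof (intro conjI allI impI ballI)
  fix d x y assume d: "c \<le> d" "x \<in> pts d" "y \<in> pts d" "d \<tturnstile> mem V (Par x)" "d \<tturnstile> Par x \<^bold>\<sqsubseteq> Par y"
  note P = based_poset[OF based_up[OF assms(1) d(1)]] and b = pts_up[OF assms(2) d(1)]
  show "d \<tturnstile> mem V (Par y)"
    using V[OF d(1)] d(2-) way_below_mono[OF P poset_refl[OF P b] _ d(5)] b by blast
next
  fix d S u assume d: "c \<le> d" and S: "d \<tturnstile> directed (mem S)" "u \<in> pts d" "d \<tturnstile> is_sup (mem S) (Par u)"
    "d \<tturnstile> mem V (Par u)"
  note B = based_up[OF assms(1) d] and b = pts_up[OF assms(2) d]
  have bu: "d \<tturnstile> Par b \<^bold>\<lless> Par u" using V d S by blast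
  show "d \<tturnstile> (\<^bold>\<exists>s. mem S s \<^bold>\<and> mem V s)"
    using B b S(2) bu
  proof (rule interpolationE)
    fix e a assume e: "d \<le> e" and a: "a \<in> pts e" "e \<tturnstile> Par b \<^bold>\<lless> Par a" "e \<tturnstile> Par a \<^bold>\<lless> Par u"
    note Su = S(1,3)[THEN forces_mono, OF e] and u = pts_up[OF S(2) e]
    note P = based_poset[OF based_up[OF B e]]
    show "e \<tturnstile> (\<^bold>\<exists>s. mem S s \<^bold>\<and> mem V s)"
      using a(3) Su(1) u Su(2) poset_refl[OF P u]
    proof (rule way_belowE)
      fix f s assume f: "e \<le> f" and s: "s \<in> pts f" "f \<tturnstile> mem S (Par s)" "f \<tturnstile> Par a \<^bold>\<sqsubseteq> Par s"
      note Pf = forces_mono[OF P f] and bf = pts_up[OF pts_up[OF b e] f]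
      have "f \<tturnstile> Par b \<^bold>\<lless> Par s"
        using way_below_mono[OF Pf poset_refl[OF Pf bf] forces_mono[OF a(2) f] s(3)] bf pts_up[OF a(1) f] s(1) by blast
      then have "f \<tturnstile> mem V (Par s)"
        using V order_trans[OF d order_trans[OF e f]] s(1) by blast
      with s show "f \<tturnstile> (\<^bold>\<exists>s. mem S s \<^bold>\<and> mem V s)"
        by (intro forces_ex1I[of _ _ s]) (simp_all add: forces_And substitutive_simps)
    qed
  qed
qed

text \<open>The approximants of \<open>x\<close> are directed with supremum \<open>x\<close>, so an
  open set containing \<open>x\<close> contains one of them.\<close>

lemma open_basisE:
  assumes "based c B" "c \<tturnstile> scott_open (mem U)" "x \<in> pts c" "c \<tturnstile> mem U (Par x)"
    and r: "\<And>d b. \<lbrakk>c \<le> d; b \<in> pts d; d \<tturnstile> mem B (Par b); d \<tturnstile> Par b \<^bold>\<lless> Par x; d \<tturnstile> mem U (Par b)\<rbrakk>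
      \<Longrightarrow> d \<tturnstile> r"
  shows "c \<tturnstile> r"
  using assms(1,3)
proof (rule approximantsE)
  fix d S assume d: "c \<le> d" and S: "d \<tturnstile> directed (mem S)" "d \<tturnstile> is_sup (mem S) (Par x)"
      "\<And>e a. d \<le> e \<Longrightarrow> a \<in> pts e \<Longrightarrow> (e \<tturnstile> mem S (Par a)) \<longleftrightarrow> (e \<tturnstile> mem B (Par a)) \<and> (e \<tturnstile> Par a \<^bold>\<lless> Par x)"
  show "d \<tturnstile> r"
    using forces_mono[OF assms(2) d] S(1) pts_up[OF assms(3) d] S(2) forces_mono[OF assms(4) d]
    by (rule scott_openE) (use S(3) r d order_trans in blast)
qed

section \<open>Families of subsets\<close>

lemma subset_syntax:
  "name_bound ((\<lambda>x. In x S) \<^bold>\<subseteq> (\<lambda>x. In x T)) = 1"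
  "1 \<le> n \<Longrightarrow> inst1 n a ((\<lambda>x. In x S) \<^bold>\<subseteq> (\<lambda>x. In x T)) = ((\<lambda>x. In x S) \<^bold>\<subseteq> (\<lambda>x. In x T))"
  "1 \<le> n \<Longrightarrow> inst2 n A ((\<lambda>x. In x S) \<^bold>\<subseteq> (\<lambda>x. In x T)) = ((\<lambda>x. In x (put n A S)) \<^bold>\<subseteq> (\<lambda>x. In x (put n A T)))"
  by (simp_all add: subset_def binder_defs)

lemma way_above_family_syntax:
  "name_bound (way_above_family (\<lambda>x. In x T) (\<lambda>x. In x U)) = 6"
  "6 \<le> n \<Longrightarrow> inst1 n a (way_above_family (\<lambda>x. In x T) (\<lambda>x. In x U)) = way_above_family (\<lambda>x. In x T) (\<lambda>x. In x U)"
  "6 \<le> n \<Longrightarrow> inst2 n A (way_above_family (\<lambda>x. In x T) (\<lambda>x. In x U)) =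
    way_above_family (\<lambda>x. In x (put n A T)) (\<lambda>x. In x (put n A U))"
  by (simp_all add: way_above_family_def set_eq_def binder_defs domain_syntax)

abbreviation "notnot_interior U \<equiv> interior scott_open (log_compl (log_compl U))"

lemma notnot_interior_syntax:
  "name_bound (notnot_interior (\<lambda>x. In x T) v) = 5"
  "5 \<le> n \<Longrightarrow> inst1 n a (notnot_interior (\<lambda>x. In x T) v) = notnot_interior (\<lambda>x. In x T) (put n a v)"
  "5 \<le> n \<Longrightarrow> inst2 n A (notnot_interior (\<lambda>x. In x T) v) = notnot_interior (\<lambda>x. In x (put n A T)) v"
  by (simp_all add: interior_def log_compl_def subset_def binder_defs domain_syntax)

lemma compl_syntax:
  "name_bound (compl apart (\<lambda>x. In x T) v) = 6"
  "6 \<le> n \<Longrightarrow> inst1 n a (compl apart (\<lambda>x. In x T) v) = compl apart (\<lambda>x. In x T) (put n a v)"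
  "6 \<le> n \<Longrightarrow> inst2 n A (compl apart (\<lambda>x. In x T) v) = compl apart (\<lambda>x. In x (put n A T)) v"
  by (simp_all add: compl_def binder_defs domain_syntax)

lemma apart_compl_syntax:
  "name_bound (apart_compl scott_open apart (\<lambda>x. In x T) v) = 8"
  "8 \<le> n \<Longrightarrow> inst1 n a (apart_compl scott_open apart (\<lambda>x. In x T) v) = apart_compl scott_open apart (\<lambda>x. In x T) (put n a v)"
  "8 \<le> n \<Longrightarrow> inst2 n A (apart_compl scott_open apart (\<lambda>x. In x T) v) = apart_compl scott_open apart (\<lambda>x. In x (put n A T)) v"
  by (simp_all add: apart_compl_def interior_def subset_def binder_defs domain_syntax compl_syntax)

lemma nearly_open_syntax:
  "name_bound (nearly_open scott_open apart (\<lambda>x. In x T)) = 10"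
  "10 \<le> n \<Longrightarrow> inst1 n a (nearly_open scott_open apart (\<lambda>x. In x T)) = nearly_open scott_open apart (\<lambda>x. In x T)"
  "10 \<le> n \<Longrightarrow> inst2 n A (nearly_open scott_open apart (\<lambda>x. In x T)) = nearly_open scott_open apart (\<lambda>x. In x (put n A T))"
  by (simp_all add: nearly_open_def set_eq_def binder_defs domain_syntax apart_compl_syntax)

lemmas families_syntax = subset_syntax way_above_family_syntax notnot_interior_syntax compl_syntax
  apart_compl_syntax nearly_open_syntax

lemma apartness_topology_syntax:
  "name_bound (apartness_topology scott_open apart (\<lambda>x. In x T)) = 12"
  "12 \<le> n \<Longrightarrow> inst2 n A (apartness_topology scott_open apart (\<lambda>x. In x T)) =
    apartness_topology scott_open apart (\<lambda>x. In x (put n A T))"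
  by (simp_all add: apartness_topology_def topology_with_basic_opens_def binder_defs domain_syntax families_syntax)

lemma notnot_stable_basis_syntax:
  "name_bound (notnot_stable_basis scott_open (way_above_family (\<lambda>x. In x T))) = 9"
  "9 \<le> n \<Longrightarrow> inst2 n A (notnot_stable_basis scott_open (way_above_family (\<lambda>x. In x T))) =
    notnot_stable_basis scott_open (way_above_family (\<lambda>x. In x (put n A T)))"
  by (simp_all add: notnot_stable_basis_def topology_basis_def topology_with_basic_opens_def set_eq_def
     binder_defs domain_syntax families_syntax)

lemma conditions_syntax:
  "name_bound (notnot_stable_way_below (\<lambda>x. In x T)) = 6"
  "6 \<le> n \<Longrightarrow> inst2 n A (notnot_stable_way_below (\<lambda>x. In x T)) = notnot_stable_way_below (\<lambda>x. In x (put n A T))"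
  "name_bound (notnot_stable_order (\<lambda>x. In x T)) = 2"
  "2 \<le> n \<Longrightarrow> inst2 n A (notnot_stable_order (\<lambda>x. In x T)) = notnot_stable_order (\<lambda>x. In x (put n A T))"
  "name_bound (decidable_way_below (\<lambda>x. In x T)) = 6"
  "6 \<le> n \<Longrightarrow> inst2 n A (decidable_way_below (\<lambda>x. In x T)) = decidable_way_below (\<lambda>x. In x (put n A T))"
  "name_bound (decidable_order (\<lambda>x. In x T)) = 2"
  "2 \<le> n \<Longrightarrow> inst2 n A (decidable_order (\<lambda>x. In x T)) = decidable_order (\<lambda>x. In x (put n A T))"
  by (simp_all add: notnot_stable_way_below_def notnot_stable_order_def decidable_way_below_def
    decidable_order_def decidable_def binder_defs domain_syntax)

lemma continuous_dcpo_syntax: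
  "name_bound continuous_dcpo = 8"
  "8 \<le> n \<Longrightarrow> inst2 n A continuous_dcpo = continuous_dcpo"
  \<comment> \<open>Unfolding \<open>directed\<close> and \<open>is_sup\<close> only at the set of
    elements way below \<open>x\<close> leaves their occurrences at set variables folded, where the
    equations above apply.\<close>
  by (simp_all add: continuous_dcpo_def dcpo_def poset_def directed_def[of "\<lambda>y. y \<^bold>\<lless> x" for x]
    is_sup_def[of "\<lambda>y. y \<^bold>\<lless> x" for x] binder_defs domain_syntax)

lemma dcpo_basis_syntax:
  "name_bound (dcpo_basis (\<lambda>x. In x T)) = 8"
  "8 \<le> n \<Longrightarrow> inst2 n A (dcpo_basis (\<lambda>x. In x T)) = dcpo_basis (\<lambda>x. In x (put n A T))"
  by (simp_all add: dcpo_basis_def directed_def is_sup_def binder_defs domain_syntax)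

text \<open>Both clauses of Scott openness pass from an open neighbourhood \<open>V\<close> inside
  \<open>U\<close> to \<open>U\<close>. The premise has elimination form because \<open>V\<close>
  may exist only in a larger context, and \<open>r\<close> is arbitrary because the two clauses use
  it with different goals.\<close>

lemma scott_openI_local:
  assumes loc: "\<And>d x r. \<lbrakk>c \<le> d; x \<in> pts d; d \<tturnstile> mem U (Par x);
    \<And>e V. \<lbrakk>d \<le> e; e \<tturnstile> scott_open (mem V);
      \<And>f a. \<lbrakk>e \<le> f; a \<in> pts f; f \<tturnstile> mem V (Par a)\<rbrakk> \<Longrightarrow> f \<tturnstile> mem U (Par a);
      e \<tturnstile> mem V (Par x)\<rbrakk> \<Longrightarrow> e \<tturnstile> r\<rbrakk> \<Longrightarrow> d \<tturnstile> r"
  shows "c \<tturnstile> scott_open (mem U)"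
  unfolding forces_scott_open
proof (intro conjI allI impI ballI)
  fix d x y assume d: "c \<le> d" "x \<in> pts d" and y: "y \<in> pts d" and x: "d \<tturnstile> mem U (Par x)"
    and le: "d \<tturnstile> Par x \<^bold>\<sqsubseteq> Par y"
  show "d \<tturnstile> mem U (Par y)"
    using d x
  proof (rule loc)
    fix e V assume e: "d \<le> e" and V: "e \<tturnstile> scott_open (mem V)"
      "\<And>f a. \<lbrakk>e \<le> f; a \<in> pts f; f \<tturnstile> mem V (Par a)\<rbrakk> \<Longrightarrow> f \<tturnstile> mem U (Par a)" "e \<tturnstile> mem V (Par x)"
    have "e \<tturnstile> mem V (Par y)"
      using scott_open_upper[OF V(1) pts_up[OF d(2) e] pts_up[OF y e] V(3) forces_mono[OF le e]] .
    then show "e \<tturnstile> mem U (Par y)" using V(2) pts_up[OF y e] by blast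
  qed
next
  fix d S u assume d: "c \<le> d" and S: "d \<tturnstile> directed (mem S)" and u: "u \<in> pts d"
    and sup: "d \<tturnstile> is_sup (mem S) (Par u)" and Uu: "d \<tturnstile> mem U (Par u)"
  show "d \<tturnstile> (\<^bold>\<exists>s. mem S s \<^bold>\<and> mem U s)"
    using d u Uu
  proof (rule loc)
    fix e V assume e: "d \<le> e" and V: "e \<tturnstile> scott_open (mem V)"
      "\<And>f a. \<lbrakk>e \<le> f; a \<in> pts f; f \<tturnstile> mem V (Par a)\<rbrakk> \<Longrightarrow> f \<tturnstile> mem U (Par a)" "e \<tturnstile> mem V (Par u)"
    show "e \<tturnstile> (\<^bold>\<exists>s. mem S s \<^bold>\<and> mem U s)"
      using V(1) forces_mono[OF S e] pts_up[OF u e] forces_mono[OF sup e] V(3)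
    proof (rule scott_openE)
      fix f s assume "e \<le> f" "s \<in> pts f" "f \<tturnstile> mem S (Par s)" "f \<tturnstile> mem V (Par s)"
      then show "f \<tturnstile> (\<^bold>\<exists>s. mem S s \<^bold>\<and> mem U s)"
        using V(2) by (intro forces_ex1I[of _ _ s]) (simp_all add: forces_And substitutive_simps)
    qed
  qed
qed

section \<open>Interiors, inclusions and families under forcing\<close>

lemma forces_interiorI:
  assumes "c \<tturnstile> scott_open (mem U)" "c \<tturnstile> mem U \<^bold>\<subseteq> Y" "c \<tturnstile> mem U (Par x)"
    and "substitutive2 (\<lambda>U. scott_open U \<^bold>\<and> U \<^bold>\<subseteq> Y \<^bold>\<and> U (Par x))"
  shows "c \<tturnstile> interior scott_open Y (Par x)"
  unfolding interior_def
  by (rule forces_ex2I[of _ _ U]) (use assms in \<open>simp_all add: forces_And\<close>)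

lemma forces_interiorE:
  assumes "c \<tturnstile> interior scott_open Y (Par x)"
    and "\<And>d U. \<lbrakk>c \<le> d; d \<tturnstile> scott_open (mem U); d \<tturnstile> mem U \<^bold>\<subseteq> Y; d \<tturnstile> mem U (Par x)\<rbrakk> \<Longrightarrow> d \<tturnstile> r"
    and "substitutive2 (\<lambda>U. scott_open U \<^bold>\<and> U \<^bold>\<subseteq> Y \<^bold>\<and> U (Par x))"
  shows "c \<tturnstile> r"
  using assms(1) unfolding interior_def
  by (rule forces_ex2E) (use assms(2,3) in \<open>auto simp: forces_And\<close>)

lemma forces_subset:
  "substitutive1 (\<lambda>x. S x \<^bold>\<longrightarrow> T x) \<Longrightarrow>
    (c \<tturnstile> S \<^bold>\<subseteq> T) \<longleftrightarrow> (\<forall>d\<ge>c. \<forall>x\<in>pts d. (d \<tturnstile> S (Par x)) \<longrightarrow> (d \<tturnstile> T (Par x)))"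
  by (simp add: subset_def forces_all1 forces_Imp) (meson order_refl order_trans pts_up)

lemma forces_set_eq:
  "substitutive1 (\<lambda>x. S x \<^bold>\<longleftrightarrow> T x) \<Longrightarrow>
    (c \<tturnstile> S \<^bold>\<doteq> T) \<longleftrightarrow> (\<forall>d\<ge>c. \<forall>x\<in>pts d. (d \<tturnstile> S (Par x)) \<longleftrightarrow> (d \<tturnstile> T (Par x)))"
  by (simp add: set_eq_def forces_all1 forces_Iff) (meson order_refl order_trans pts_up)

text \<open>The rules for \<open>interior\<close> concern an arbitrary predicate and so carry a
  substitutivity premise; this discharges it for double complements.\<close>

lemma substitutive_notnot_interior: "substitutive2 (\<lambda>U. scott_open U \<^bold>\<and> U \<^bold>\<subseteq> log_compl (log_compl (mem A)) \<^bold>\<and> U (Par x))"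
  by (simp add: substitutive_simps subset_def log_compl_def)

lemma substitutive_apart_compl: "substitutive2 (\<lambda>U. scott_open U \<^bold>\<and> U \<^bold>\<subseteq> compl apart (mem A) \<^bold>\<and> U (Par x))"
  by (simp add: substitutive_simps subset_def compl_syntax)

lemma forces_subset_notnot:
  "(c \<tturnstile> mem U \<^bold>\<subseteq> log_compl (log_compl (mem A))) \<longleftrightarrow>
    (\<forall>d\<ge>c. \<forall>x\<in>pts d. (d \<tturnstile> mem U (Par x)) \<longrightarrow> (d \<tturnstile> \<^bold>\<not> \<^bold>\<not> mem A (Par x)))"
  by (subst forces_subset) (simp_all add: substitutive_simps log_compl_def)

lemma forces_subset_compl:
  "(c \<tturnstile> mem U \<^bold>\<subseteq> compl apart (mem A)) \<longleftrightarrow>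
    (\<forall>d\<ge>c. \<forall>x\<in>pts d. (d \<tturnstile> mem U (Par x)) \<longrightarrow>
      (\<forall>e\<ge>d. \<forall>y\<in>pts e. (e \<tturnstile> mem A (Par y)) \<longrightarrow> (e \<tturnstile> Par x \<^bold>\<sharp> Par y)))"
  by (subst forces_subset, simp add: substitutive_simps compl_syntax)
    (simp add: compl_def forces_simps)

lemma forces_subset_mem:
  "(c \<tturnstile> mem U \<^bold>\<subseteq> mem V) \<longleftrightarrow>
    (\<forall>d\<ge>c. \<forall>x\<in>pts d. (d \<tturnstile> mem U (Par x)) \<longrightarrow> (d \<tturnstile> mem V (Par x)))"
  by (subst forces_subset) (simp_all add: substitutive_simps)

lemma forces_way_above_familyE:
  assumes "c \<tturnstile> way_above_family (mem B) (mem U)"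
    and r: "\<And>d b. \<lbrakk>c \<le> d; b \<in> pts d; d \<tturnstile> mem B (Par b);
      \<And>e a. d \<le> e \<Longrightarrow> a \<in> pts e \<Longrightarrow> (e \<tturnstile> mem U (Par a)) \<longleftrightarrow> (e \<tturnstile> Par b \<^bold>\<lless> Par a)\<rbrakk> \<Longrightarrow> d \<tturnstile> r"
  shows "c \<tturnstile> r"
  using assms(1) unfolding way_above_family_def
proof (rule forces_ex1E)
  fix d b assume d: "c \<le> d" "b \<in> pts d" and *: "d \<tturnstile> mem B (Par b) \<^bold>\<and> mem U \<^bold>\<doteq> (\<lambda>x. Par b \<^bold>\<lless> x)"
  from * have "d \<tturnstile> mem B (Par b)" "d \<tturnstile> mem U \<^bold>\<doteq> (\<lambda>x. Par b \<^bold>\<lless> x)" by (simp_all add: forces_And)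
  then show "d \<tturnstile> r"
    using r d by (subst (asm) forces_set_eq) (simp_all add: substitutive_simps)
qed (simp add: substitutive_simps set_eq_def)

lemma forces_way_above_familyI:
  assumes "b \<in> pts c" "c \<tturnstile> mem B (Par b)"
    and "\<And>e a. c \<le> e \<Longrightarrow> a \<in> pts e \<Longrightarrow> (e \<tturnstile> mem U (Par a)) \<longleftrightarrow> (e \<tturnstile> Par b \<^bold>\<lless> Par a)"
  shows "c \<tturnstile> way_above_family (mem B) (mem U)"
  unfolding way_above_family_def
proof (rule forces_ex1I[of _ _ b])
  have "c \<tturnstile> mem U \<^bold>\<doteq> (\<lambda>x. Par b \<^bold>\<lless> x)"
    by (subst forces_set_eq) (use assms in \<open>simp_all add: substitutive_simps\<close>)
  then show "c \<tturnstile> mem B (Par b) \<^bold>\<and> mem U \<^bold>\<doteq> (\<lambda>x. Par b \<^bold>\<lless> x)"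
    using assms by (simp add: forces_And)
qed (use assms in \<open>simp_all add: substitutive_simps set_eq_def\<close>)

lemma forces_nearly_openE:
  assumes "c \<tturnstile> nearly_open scott_open apart (mem N)"
    and r: "\<And>d A. \<lbrakk>c \<le> d; \<And>e a. d \<le> e \<Longrightarrow> a \<in> pts e \<Longrightarrow>
      (e \<tturnstile> mem N (Par a)) \<longleftrightarrow> (e \<tturnstile> interior scott_open (compl apart (mem A)) (Par a))\<rbrakk> \<Longrightarrow> d \<tturnstile> r"
  shows "c \<tturnstile> r"
  using assms(1) unfolding nearly_open_def
proof (rule forces_ex2E)
  fix d A assume d: "c \<le> d" and *: "d \<tturnstile> mem N \<^bold>\<doteq> apart_compl scott_open apart (mem A)"
  then show "d \<tturnstile> r"
    using r by (subst (asm) forces_set_eq) (simp_all add: substitutive_simps apart_compl_syntax,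
        simp add: apart_compl_def)
qed (simp add: substitutive_simps set_eq_def apart_compl_syntax)

lemma forces_nearly_openI:
  assumes "\<And>e a. c \<le> e \<Longrightarrow> a \<in> pts e \<Longrightarrow>
      (e \<tturnstile> mem N (Par a)) \<longleftrightarrow> (e \<tturnstile> interior scott_open (compl apart (mem A)) (Par a))"
  shows "c \<tturnstile> nearly_open scott_open apart (mem N)"
  unfolding nearly_open_def
proof (rule forces_ex2I[of _ _ A])
  show "c \<tturnstile> mem N \<^bold>\<doteq> apart_compl scott_open apart (mem A)"
    by (subst forces_set_eq, simp add: substitutive_simps apart_compl_syntax)
      (use assms in \<open>simp add: apart_compl_def\<close>)
qed (simp add: substitutive_simps set_eq_def apart_compl_syntax)

lemma forces_notnot_stable_basis:
  "(c \<tturnstile> notnot_stable_basis scott_open (way_above_family (mem B))) \<longleftrightarrow>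
    (\<forall>d\<ge>c. \<forall>U. (d \<tturnstile> way_above_family (mem B) (mem U)) \<longrightarrow> (d \<tturnstile> scott_open (mem U))) \<and>
    (\<forall>d\<ge>c. \<forall>U. (d \<tturnstile> scott_open (mem U)) \<longrightarrow> (\<forall>x\<in>pts d. (d \<tturnstile> mem U (Par x)) \<longrightarrow>
      (d \<tturnstile> (\<^bold>\<exists>\<^sub>s\<^sub>e\<^sub>tV. way_above_family (mem B) V \<^bold>\<and> V \<^bold>\<subseteq> mem U \<^bold>\<and> V (Par x))))) \<and>
    (\<forall>d\<ge>c. \<forall>U. (d \<tturnstile> way_above_family (mem B) (mem U)) \<longrightarrow> (\<forall>x\<in>pts d.
      (\<forall>e\<ge>d. (e \<tturnstile> mem U (Par x)) \<longrightarrow> (e \<tturnstile> notnot_interior (mem U) (Par x))) \<and>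
      (\<forall>e\<ge>d. (e \<tturnstile> notnot_interior (mem U) (Par x)) \<longrightarrow> (e \<tturnstile> mem U (Par x)))))"
  by (simp add: notnot_stable_basis_def topology_basis_def topology_with_basic_opens_def set_eq_def
    forces_simps families_syntax)

lemma forces_apartness_topology:
  "(c \<tturnstile> apartness_topology scott_open apart (mem U)) \<longleftrightarrow>
    (\<forall>d\<ge>c. \<forall>x\<in>pts d. (d \<tturnstile> mem U (Par x)) \<longrightarrow>
      (d \<tturnstile> (\<^bold>\<exists>\<^sub>s\<^sub>e\<^sub>tV. nearly_open scott_open apart V \<^bold>\<and> V \<^bold>\<subseteq> mem U \<^bold>\<and> V (Par x))))"
  by (simp add: apartness_topology_def topology_with_basic_opens_def
    forces_simps families_syntax)

section \<open>Apartness and double negation\<close>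

lemma forces_apartI:
  assumes "c \<tturnstile> scott_open (mem U)" "c \<tturnstile> mem U (Par x)" "c \<tturnstile> \<^bold>\<not> mem U (Par y)"
  shows "c \<tturnstile> Par x \<^bold>\<sharp> Par y"
  unfolding apart_def
  by (rule forces_OrI1, rule forces_ex2I[of _ _ U])
    (use assms in \<open>simp_all add: forces_And substitutive2_def Let_def domain_syntax Neg_def put_def\<close>)

lemma forces_NegE: "c \<tturnstile> \<^bold>\<not> p \<Longrightarrow> c \<tturnstile> p \<Longrightarrow> c \<tturnstile> r"
  unfolding forces_Neg using forces_Falsum by blast

lemma forces_NegI: "(\<And>d. c \<le> d \<Longrightarrow> d \<tturnstile> p \<Longrightarrow> d \<tturnstile> \<^bold>\<bottom>) \<Longrightarrow> c \<tturnstile> \<^bold>\<not> p"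
  unfolding forces_Neg by blast

text \<open>Either disjunct gives a Scott open set that both contains and omits \<open>x\<close>.
  The conclusion is an arbitrary \<open>r\<close> because an inconsistent context forces
  everything.\<close>

lemma apart_irrefl:
  assumes "c \<tturnstile> Par x \<^bold>\<sharp> Par x"
  shows "c \<tturnstile> r"
proof -
  have *: "d \<tturnstile> r" if "d \<tturnstile> (\<^bold>\<exists>\<^sub>s\<^sub>e\<^sub>tU. scott_open U \<^bold>\<and> U (Par x) \<^bold>\<and> \<^bold>\<not> U (Par x))" for d
    using that
    by (rule forces_ex2E)
      (auto simp: forces_And substitutive2_def Let_def domain_syntax put_def
        Neg_def[of "In _ _"] intro: forces_NegE[unfolded Neg_def])
  show ?thesis
    using assms unfolding apart_def by (rule forces_OrE) (rule *, assumption)+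
qed

lemma notnotI: "c \<tturnstile> p \<Longrightarrow> c \<tturnstile> \<^bold>\<not> \<^bold>\<not> p"
  by (rule forces_NegI) (blast intro: forces_NegE forces_mono)

lemma notnot_mono:
  assumes "c \<tturnstile> \<^bold>\<not> \<^bold>\<not> p" "\<And>d. c \<le> d \<Longrightarrow> d \<tturnstile> p \<Longrightarrow> d \<tturnstile> q"
  shows "c \<tturnstile> \<^bold>\<not> \<^bold>\<not> q"
proof (rule forces_NegI)
  fix d assume d: "c \<le> d" "d \<tturnstile> \<^bold>\<not> q"
  have "d \<tturnstile> \<^bold>\<not> p"
  proof (rule forces_NegI)
    fix e assume e: "d \<le> e" "e \<tturnstile> p"
    show "e \<tturnstile> \<^bold>\<bottom>"
      using forces_mono[OF d(2) e(1)] assms(2)[OF order_trans[OF d(1) e(1)] e(2)] by (rule forces_NegE)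
  qed
  with forces_mono[OF assms(1) d(1)] show "d \<tturnstile> \<^bold>\<bottom>" by (rule forces_NegE)
qed

text \<open>In the case of the negation, the doubly negated premise makes the context inconsistent,
  so \<open>p\<close> is forced there as well.\<close>

lemma decidable_stable:
  assumes "c \<tturnstile> decidable p" "c \<tturnstile> \<^bold>\<not> \<^bold>\<not> p"
  shows "c \<tturnstile> p"
  using assms(1) unfolding decidable_def
  by (rule forces_OrE) (use assms(2) forces_NegE forces_mono in blast)+

section \<open>Stability and the apartness topology\<close>

text \<open>The common consequence of the four conditions. With way-below in the premise and the
  order in the conclusion, it follows from stability of either relation.\<close>

definition order_stable :: "ctx \<Rightarrow> nat \<Rightarrow> bool" where
  "order_stable c B \<longleftrightarrow> (\<forall>d\<ge>c. \<forall>a\<in>pts d. \<forall>b\<in>pts d. (d \<tturnstile> mem B (Par a)) \<longrightarrow> (d \<tturnstile> mem B (Par b)) \<longrightarrow>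
    (d \<tturnstile> \<^bold>\<not> \<^bold>\<not> (Par a \<^bold>\<lless> Par b)) \<longrightarrow> (d \<tturnstile> Par a \<^bold>\<sqsubseteq> Par b))"

lemma order_stable_up: "order_stable c B \<Longrightarrow> c \<le> d \<Longrightarrow> order_stable d B"
  unfolding order_stable_def using order_trans by blast

lemma forces_conditions:
  "(c \<tturnstile> notnot_stable_way_below (mem B)) \<longleftrightarrow> (\<forall>d\<ge>c. \<forall>a\<in>pts d. \<forall>b\<in>pts d.
    (d \<tturnstile> mem B (Par a)) \<longrightarrow> (d \<tturnstile> mem B (Par b)) \<longrightarrow> (d \<tturnstile> \<^bold>\<not> \<^bold>\<not> (Par a \<^bold>\<lless> Par b)) \<longrightarrow> (d \<tturnstile> Par a \<^bold>\<lless> Par b))"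
  "(c \<tturnstile> notnot_stable_order (mem B)) \<longleftrightarrow> (\<forall>d\<ge>c. \<forall>a\<in>pts d. \<forall>b\<in>pts d.
    (d \<tturnstile> mem B (Par a)) \<longrightarrow> (d \<tturnstile> mem B (Par b)) \<longrightarrow> (d \<tturnstile> \<^bold>\<not> \<^bold>\<not> (Par a \<^bold>\<sqsubseteq> Par b)) \<longrightarrow> (d \<tturnstile> Par a \<^bold>\<sqsubseteq> Par b))"
  "(c \<tturnstile> decidable_way_below (mem B)) \<longleftrightarrow> (\<forall>d\<ge>c. \<forall>a\<in>pts d. \<forall>b\<in>pts d.
    (d \<tturnstile> mem B (Par a)) \<longrightarrow> (d \<tturnstile> mem B (Par b)) \<longrightarrow> (d \<tturnstile> decidable (Par a \<^bold>\<lless> Par b)))"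
  "(c \<tturnstile> decidable_order (mem B)) \<longleftrightarrow> (\<forall>d\<ge>c. \<forall>a\<in>pts d. \<forall>b\<in>pts d.
    (d \<tturnstile> mem B (Par a)) \<longrightarrow> (d \<tturnstile> mem B (Par b)) \<longrightarrow> (d \<tturnstile> decidable (Par a \<^bold>\<sqsubseteq> Par b)))"
  by (simp_all add: notnot_stable_way_below_def notnot_stable_order_def decidable_way_below_def
    decidable_order_def decidable_def forces_simps)

text \<open>A forced disjunction does not split, but an implication from one does. This reduces the
  disjunction of the four conditions to separate implications.\<close>

lemma forces_Or_Imp:
  "(c \<tturnstile> p \<^bold>\<or> q \<^bold>\<longrightarrow> r) \<longleftrightarrow> (c \<tturnstile> p \<^bold>\<longrightarrow> r) \<and> (c \<tturnstile> q \<^bold>\<longrightarrow> r)"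
proof
  assume "c \<tturnstile> p \<^bold>\<or> q \<^bold>\<longrightarrow> r"
  then show "(c \<tturnstile> p \<^bold>\<longrightarrow> r) \<and> (c \<tturnstile> q \<^bold>\<longrightarrow> r)"
    unfolding forces_Imp using forces_OrI1 forces_OrI2 by blast
next
  assume *: "(c \<tturnstile> p \<^bold>\<longrightarrow> r) \<and> (c \<tturnstile> q \<^bold>\<longrightarrow> r)"
  show "c \<tturnstile> p \<^bold>\<or> q \<^bold>\<longrightarrow> r"
    unfolding forces_Imp
  proof (intro allI impI)
    fix d assume d: "c \<le> d" and "d \<tturnstile> p \<^bold>\<or> q"
    from this(2) show "d \<tturnstile> r"
      by (rule forces_OrE) (use * d order_trans in \<open>unfold forces_Imp, blast\<close>)+
  qed
qed

text \<open>Way-below implies the order. For conditions on way-below this is used after removing the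
  double negation (\<open>le\<close>), for conditions on the order underneath it
  (\<open>nn\<close>); the decidable cases first pass to stability.\<close>

lemma order_stable_conditions:
  assumes P: "c \<tturnstile> poset"
  shows "c \<tturnstile> notnot_stable_way_below (mem B) \<Longrightarrow> order_stable c B"
    and "c \<tturnstile> notnot_stable_order (mem B) \<Longrightarrow> order_stable c B"
    and "c \<tturnstile> decidable_way_below (mem B) \<Longrightarrow> order_stable c B"
    and "c \<tturnstile> decidable_order (mem B) \<Longrightarrow> order_stable c B"
proof -
  have le: "d \<tturnstile> Par a \<^bold>\<sqsubseteq> Par b"
    if "c \<le> d" "a \<in> pts d" "b \<in> pts d" "d \<tturnstile> Par a \<^bold>\<lless> Par b" for d a b
    using way_below_imp_le[OF forces_mono[OF P that(1)]] that by blast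
  have nn: "d \<tturnstile> \<^bold>\<not> \<^bold>\<not> (Par a \<^bold>\<sqsubseteq> Par b)"
    if d: "c \<le> d" "a \<in> pts d" "b \<in> pts d" "d \<tturnstile> \<^bold>\<not> \<^bold>\<not> (Par a \<^bold>\<lless> Par b)" for d a b
    using d(4)
  proof (rule notnot_mono)
    fix e assume "d \<le> e" "e \<tturnstile> Par a \<^bold>\<lless> Par b"
    then show "e \<tturnstile> Par a \<^bold>\<sqsubseteq> Par b"
      using le[OF order_trans[OF d(1)]] d(2,3)[THEN pts_up] by blast
  qed
  show "c \<tturnstile> notnot_stable_way_below (mem B) \<Longrightarrow> order_stable c B"
    using le unfolding forces_conditions order_stable_def by blast
  show "c \<tturnstile> notnot_stable_order (mem B) \<Longrightarrow> order_stable c B"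
    using nn unfolding forces_conditions order_stable_def by blast
  show "c \<tturnstile> decidable_way_below (mem B) \<Longrightarrow> order_stable c B"
    using le decidable_stable unfolding forces_conditions order_stable_def by blast
  show "c \<tturnstile> decidable_order (mem B) \<Longrightarrow> order_stable c B"
    using nn decidable_stable unfolding forces_conditions order_stable_def by blast
qed

text \<open>The double negation can be removed only between basis elements, so \<open>x\<close> is
  first replaced by a basis element \<open>a \<lless> x\<close> in \<open>W\<close>. Stability gives
  only \<open>b \<sqsubseteq> a\<close>, and \<open>a \<lless> x\<close> restores the way-below
  relation.\<close>

lemma notnot_way_above_open:
  assumes "based c B" "order_stable c B" "b \<in> pts c" "c \<tturnstile> mem B (Par b)"
    and W: "c \<tturnstile> scott_open (mem W)" "x \<in> pts c" "c \<tturnstile> mem W (Par x)"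
      "\<And>d a. \<lbrakk>c \<le> d; a \<in> pts d; d \<tturnstile> mem W (Par a)\<rbrakk> \<Longrightarrow> d \<tturnstile> \<^bold>\<not> \<^bold>\<not> (Par b \<^bold>\<lless> Par a)"
  shows "c \<tturnstile> Par b \<^bold>\<lless> Par x"
  using assms(1) W(1-3)
proof (rule open_basisE)
  fix d a assume d: "c \<le> d" and a: "a \<in> pts d" "d \<tturnstile> mem B (Par a)" "d \<tturnstile> Par a \<^bold>\<lless> Par x"
    "d \<tturnstile> mem W (Par a)"
  note P = based_poset[OF based_up[OF assms(1) d]]
    and b = pts_up[OF assms(3) d] and x = pts_up[OF W(2) d]
  have "d \<tturnstile> \<^bold>\<not> \<^bold>\<not> (Par b \<^bold>\<lless> Par a)" using W(4) d a by blast
  then have "d \<tturnstile> Par b \<^bold>\<sqsubseteq> Par a"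
    using assms(2) d a(1,2) b forces_mono[OF assms(4) d] unfolding order_stable_def by blast
  then show "d \<tturnstile> Par b \<^bold>\<lless> Par x"
    using way_below_mono[OF P _ a(3) poset_refl[OF P x]] a(1) b x by blast
qed

text \<open>Take a basis element \<open>b \<lless> x\<close> in \<open>U\<close>. All points that
  \<open>b\<close> is way below are above \<open>b\<close>, hence in the upper set \<open>U\<close>;
  comprehension makes them a set parameter \<open>V\<close>.\<close>

lemma way_above_neighbourhoodE:
  assumes "based c B" "c \<tturnstile> scott_open (mem U)" "x \<in> pts c" "c \<tturnstile> mem U (Par x)"
    and r: "\<And>d b V. \<lbrakk>c \<le> d; b \<in> pts d; d \<tturnstile> mem B (Par b); d \<tturnstile> mem V \<^bold>\<subseteq> mem U; d \<tturnstile> mem V (Par x);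
      \<And>e a. d \<le> e \<Longrightarrow> a \<in> pts e \<Longrightarrow> (e \<tturnstile> mem V (Par a)) \<longleftrightarrow> (e \<tturnstile> Par b \<^bold>\<lless> Par a)\<rbrakk> \<Longrightarrow> d \<tturnstile> r"
  shows "c \<tturnstile> r"
  using assms(1-4)
proof (rule open_basisE)
  fix d b assume d: "c \<le> d" and b: "b \<in> pts d" "d \<tturnstile> mem B (Par b)" "d \<tturnstile> Par b \<^bold>\<lless> Par x"
    "d \<tturnstile> mem U (Par b)"
  show "d \<tturnstile> r"
  proof (rule comprehension[of "\<lambda>y. Par b \<^bold>\<lless> y"])
    fix e V assume e: "d \<le> e"
      and V: "\<And>f a. e \<le> f \<Longrightarrow> a \<in> pts f \<Longrightarrow> (f \<tturnstile> mem V (Par a)) \<longleftrightarrow> (f \<tturnstile> Par b \<^bold>\<lless> Par a)"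
    note ce = order_trans[OF d e]
    have "e \<tturnstile> mem V \<^bold>\<subseteq> mem U"
      unfolding forces_subset_mem
    proof (intro allI impI ballI)
      fix f a assume f: "e \<le> f" and a: "a \<in> pts f" "f \<tturnstile> mem V (Par a)"
      note bf = pts_up[OF b(1) order_trans[OF e f]]
      have "f \<tturnstile> Par b \<^bold>\<sqsubseteq> Par a"
        using way_below_imp_le[OF based_poset[OF based_up[OF assms(1) order_trans[OF ce f]]] bf a(1)]
          a V[OF f] by blast
      then show "f \<tturnstile> mem U (Par a)"
        using scott_open_upper[OF forces_mono[OF assms(2) order_trans[OF ce f]] bf a(1)]
          forces_mono[OF b(4) order_trans[OF e f]] by blast
    qed
    moreover have "e \<tturnstile> mem V (Par x)"
      using V[OF order_refl pts_up[OF assms(3) ce]] forces_mono[OF b(3) e] by blast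
    ultimately show "e \<tturnstile> r"
      using r[OF ce pts_up[OF b(1) e] forces_mono[OF b(2) e]] V by blast
  qed (simp_all add: substitutive_simps way_below_syntax)
qed

section \<open>Double-negation stability of the basis\<close>

lemma notnot_stable_basis_way_above:
  assumes B: "based c B" and stable: "order_stable c B"
  shows "c \<tturnstile> notnot_stable_basis scott_open (way_above_family (mem B))"
  unfolding forces_notnot_stable_basis
proof (intro conjI allI impI ballI)
  \<comment> \<open>This block treats openness of a basic set and both inclusions of its stability
    together, as they share \<open>d\<close> and \<open>U\<close>; the neighbourhood property is
    left for the second block.\<close>
  fix d U assume d: "c \<le> d" and U: "d \<tturnstile> way_above_family (mem B) (mem U)"
  show op: "d \<tturnstile> scott_open (mem U)"
    using U by (rule forces_way_above_familyE) (use based_up[OF based_up[OF B d]] way_above_scott_open in blast)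
  fix x e assume x: "x \<in> pts d" and e: "d \<le> e"
  {
    assume Ux: "e \<tturnstile> mem U (Par x)"
    have "e \<tturnstile> mem U \<^bold>\<subseteq> log_compl (log_compl (mem U))"
      unfolding forces_subset_notnot using notnotI by blast
    with forces_mono[OF op e] show "e \<tturnstile> notnot_interior (mem U) (Par x)"
      using Ux substitutive_notnot_interior by (rule forces_interiorI)
  next
    assume int: "e \<tturnstile> notnot_interior (mem U) (Par x)"
    show "e \<tturnstile> mem U (Par x)"
      using forces_mono[OF U e]
    proof (rule forces_way_above_familyE)
      fix f b assume f: "e \<le> f" and b: "b \<in> pts f" "f \<tturnstile> mem B (Par b)"
        and U: "\<And>g a. f \<le> g \<Longrightarrow> a \<in> pts g \<Longrightarrow> (g \<tturnstile> mem U (Par a)) \<longleftrightarrow> (g \<tturnstile> Par b \<^bold>\<lless> Par a)"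
      show "f \<tturnstile> mem U (Par x)"
        using forces_mono[OF int f]
      proof (rule forces_interiorE)
        fix g W assume g: "f \<le> g" and W: "g \<tturnstile> scott_open (mem W)"
          "g \<tturnstile> mem W \<^bold>\<subseteq> log_compl (log_compl (mem U))" "g \<tturnstile> mem W (Par x)"
        note cg = order_trans[OF order_trans[OF order_trans[OF d e] f] g]
        note xg = x[THEN pts_up, OF e, THEN pts_up, OF f, THEN pts_up, OF g]
        \<comment> \<open>The open set \<open>W\<close> witnessing membership of \<open>x\<close> in
          the interior consists of points of the double complement of \<open>U\<close>, as required
          for removing the double negation.\<close>
        have "g \<tturnstile> Par b \<^bold>\<lless> Par x"
          using based_up[OF B cg] order_stable_up[OF stable cg] pts_up[OF b(1) g] forces_mono[OF b(2) g] W(1) xg W(3)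
        proof (rule notnot_way_above_open)
          fix h a assume h: "g \<le> h" "a \<in> pts h" "h \<tturnstile> mem W (Par a)"
          then have "h \<tturnstile> \<^bold>\<not> \<^bold>\<not> mem U (Par a)" using W(2) unfolding forces_subset_notnot by blast
          then show "h \<tturnstile> \<^bold>\<not> \<^bold>\<not> (Par b \<^bold>\<lless> Par a)"
            by (rule notnot_mono) (use U h(2) pts_up order_trans[OF order_trans[OF g h(1)]] in blast)
        qed
        then show "g \<tturnstile> mem U (Par x)" using U g xg by blast
      qed (rule substitutive_notnot_interior)
    qed
  }
next
  fix d U x assume d: "c \<le> d" and U: "d \<tturnstile> scott_open (mem U)" "x \<in> pts d" "d \<tturnstile> mem U (Par x)"
  let ?r = "\<^bold>\<exists>\<^sub>s\<^sub>e\<^sub>tV. way_above_family (mem B) V \<^bold>\<and> V \<^bold>\<subseteq> mem U \<^bold>\<and> V (Par x)"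
  show "d \<tturnstile> ?r"
    using based_up[OF B d] U
  proof (rule way_above_neighbourhoodE)
    fix e b V assume e: "d \<le> e" and b: "b \<in> pts e" "e \<tturnstile> mem B (Par b)"
      and V: "e \<tturnstile> mem V \<^bold>\<subseteq> mem U" "e \<tturnstile> mem V (Par x)"
        "\<And>f a. e \<le> f \<Longrightarrow> a \<in> pts f \<Longrightarrow> (f \<tturnstile> mem V (Par a)) \<longleftrightarrow> (f \<tturnstile> Par b \<^bold>\<lless> Par a)"
    have "e \<tturnstile> way_above_family (mem B) (mem V)"
      using b V(3) by (rule forces_way_above_familyI)
    with V(1,2) show "e \<tturnstile> ?r"
      by (intro forces_ex2I[of _ _ V]) (simp_all add: forces_And substitutive_simps families_syntax)
  qed
qed

section \<open>Comparison of the Scott topology with the apartness topology\<close>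

lemma nearly_open_scott_open:
  assumes "c \<tturnstile> nearly_open scott_open apart (mem N)"
  shows "c \<tturnstile> scott_open (mem N)"
  using assms
proof (rule forces_nearly_openE)
  fix d A assume N: "\<And>e a. d \<le> e \<Longrightarrow> a \<in> pts e \<Longrightarrow>
      (e \<tturnstile> mem N (Par a)) \<longleftrightarrow> (e \<tturnstile> interior scott_open (compl apart (mem A)) (Par a))"
  show "d \<tturnstile> scott_open (mem N)"
  proof (rule scott_openI_local)
    fix e x r assume e: "d \<le> e" "x \<in> pts e" "e \<tturnstile> mem N (Par x)"
      and r: "\<And>f V. \<lbrakk>e \<le> f; f \<tturnstile> scott_open (mem V);
        \<And>g a. \<lbrakk>f \<le> g; a \<in> pts g; g \<tturnstile> mem V (Par a)\<rbrakk> \<Longrightarrow> g \<tturnstile> mem N (Par a);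
        f \<tturnstile> mem V (Par x)\<rbrakk> \<Longrightarrow> f \<tturnstile> r"
    have "e \<tturnstile> interior scott_open (compl apart (mem A)) (Par x)" using N e by blast
    then show "e \<tturnstile> r"
    proof (rule forces_interiorE)
      fix f V assume f: "e \<le> f" and V: "f \<tturnstile> scott_open (mem V)"
        "f \<tturnstile> mem V \<^bold>\<subseteq> compl apart (mem A)" "f \<tturnstile> mem V (Par x)"
      \<comment> \<open>The same \<open>V\<close> witnesses that each of its points lies in the
        interior, so \<open>V\<close> is an open neighbourhood inside \<open>N\<close>.\<close>
      have "g \<tturnstile> mem N (Par a)" if g: "f \<le> g" "a \<in> pts g" "g \<tturnstile> mem V (Par a)" for g a
        unfolding N[OF order_trans[OF order_trans[OF e(1) f] g(1)] g(2)]
        using V(1,2)[THEN forces_mono, OF g(1)] g(3) substitutive_apart_compl by (rule forces_interiorI)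
      with f V show "f \<tturnstile> r" using r by blast
    qed (rule substitutive_apart_compl)
  qed
qed

text \<open>Each point of \<open>U\<close> has a nearly open neighbourhood inside \<open>U\<close>.
  Nearly open sets are Scott open, so the local criterion applies.\<close>

lemma apartness_topology_scott_open:
  assumes "c \<tturnstile> apartness_topology scott_open apart (mem U)"
  shows "c \<tturnstile> scott_open (mem U)"
proof (rule scott_openI_local)
  fix d x r assume d: "c \<le> d" "x \<in> pts d" "d \<tturnstile> mem U (Par x)"
    and r: "\<And>e V. \<lbrakk>d \<le> e; e \<tturnstile> scott_open (mem V);
      \<And>f a. \<lbrakk>e \<le> f; a \<in> pts f; f \<tturnstile> mem V (Par a)\<rbrakk> \<Longrightarrow> f \<tturnstile> mem U (Par a);
      e \<tturnstile> mem V (Par x)\<rbrakk> \<Longrightarrow> e \<tturnstile> r"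
  have "d \<tturnstile> (\<^bold>\<exists>\<^sub>s\<^sub>e\<^sub>tV. nearly_open scott_open apart V \<^bold>\<and> V \<^bold>\<subseteq> mem U \<^bold>\<and> V (Par x))"
    using assms d unfolding forces_apartness_topology by blast
  then show "d \<tturnstile> r"
  proof (rule forces_ex2E)
    fix e V assume "d \<le> e" "e \<tturnstile> nearly_open scott_open apart (mem V) \<^bold>\<and> mem V \<^bold>\<subseteq> mem U \<^bold>\<and> mem V (Par x)"
    then show "e \<tturnstile> r"
      using r nearly_open_scott_open unfolding forces_And forces_subset_mem by blast
  qed (simp add: substitutive_simps families_syntax)
qed

lemma way_above_nearly_open:
  assumes B: "based c B" and stable: "order_stable c B" and b: "b \<in> pts c" "c \<tturnstile> mem B (Par b)"
    and V: "\<And>d a. c \<le> d \<Longrightarrow> a \<in> pts d \<Longrightarrow> (d \<tturnstile> mem V (Par a)) \<longleftrightarrow> (d \<tturnstile> Par b \<^bold>\<lless> Par a)"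
  shows "c \<tturnstile> nearly_open scott_open apart (mem V)"
\<comment> \<open>The set whose apartness complement is to be \<open>V\<close> is the logical
  complement of \<open>V\<close>.\<close>
proof (rule comprehension[of "\<lambda>y. \<^bold>\<not> mem V y"])
  fix d A assume d: "c \<le> d"
    and A: "\<And>e a. d \<le> e \<Longrightarrow> a \<in> pts e \<Longrightarrow> (e \<tturnstile> mem A (Par a)) \<longleftrightarrow> (e \<tturnstile> \<^bold>\<not> mem V (Par a))"
  have op: "c \<tturnstile> scott_open (mem V)" using B b(1) V by (rule way_above_scott_open)
  show "d \<tturnstile> nearly_open scott_open apart (mem V)"
  proof (rule forces_nearly_openI)
    fix e x assume e: "d \<le> e" and x: "x \<in> pts e"
    note ce = order_trans[OF d e]
    show "(e \<tturnstile> mem V (Par x)) \<longleftrightarrow> (e \<tturnstile> interior scott_open (compl apart (mem A)) (Par x))"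
    proof
      assume Vx: "e \<tturnstile> mem V (Par x)"
      \<comment> \<open>The open set \<open>V\<close> itself separates each of its points from each
        point of \<open>A\<close>.\<close>
      have "e \<tturnstile> mem V \<^bold>\<subseteq> compl apart (mem A)"
        unfolding forces_subset_compl
      proof (intro allI impI ballI)
        fix f y g z assume f: "e \<le> f" and y: "y \<in> pts f" "f \<tturnstile> mem V (Par y)"
          and g: "f \<le> g" and z: "z \<in> pts g" "g \<tturnstile> mem A (Par z)"
        have "g \<tturnstile> \<^bold>\<not> mem V (Par z)" using A order_trans[OF order_trans[OF e f] g] z by blast
        with forces_mono[OF op order_trans[OF order_trans[OF ce f] g]] forces_mono[OF y(2) g]
        show "g \<tturnstile> Par y \<^bold>\<sharp> Par z" by (rule forces_apartI)
      qed
      with forces_mono[OF op ce] show "e \<tturnstile> interior scott_open (compl apart (mem A)) (Par x)"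
        using Vx substitutive_apart_compl by (rule forces_interiorI)
    next
      assume "e \<tturnstile> interior scott_open (compl apart (mem A)) (Par x)"
      then show "e \<tturnstile> mem V (Par x)"
      proof (rule forces_interiorE)
        fix f W assume f: "e \<le> f" and W: "f \<tturnstile> scott_open (mem W)"
          "f \<tturnstile> mem W \<^bold>\<subseteq> compl apart (mem A)" "f \<tturnstile> mem W (Par x)"
        note cf = order_trans[OF ce f] and df = order_trans[OF e f] and xf = pts_up[OF x f]
        have "f \<tturnstile> Par b \<^bold>\<lless> Par x"
          using based_up[OF B cf] order_stable_up[OF stable cf] pts_up[OF b(1) cf] forces_mono[OF b(2) cf] W(1) xf W(3)
        proof (rule notnot_way_above_open)
          fix g a assume g: "f \<le> g" and a: "a \<in> pts g" "g \<tturnstile> mem W (Par a)"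
          \<comment> \<open>If \<open>b\<close> were not way below \<open>a\<close>, then
            \<open>a\<close> would be in \<open>A\<close>; since \<open>W\<close> lies in the
            complement of \<open>A\<close>, the point \<open>a\<close> would be apart from
            itself.\<close>
          show "g \<tturnstile> \<^bold>\<not> \<^bold>\<not> (Par b \<^bold>\<lless> Par a)"
          proof (rule forces_NegI)
            fix h assume h: "g \<le> h" "h \<tturnstile> \<^bold>\<not> (Par b \<^bold>\<lless> Par a)"
            note fh = order_trans[OF g h(1)] and ah = pts_up[OF a(1) h(1)]
            have "h \<tturnstile> \<^bold>\<not> mem V (Par a)"
            proof (rule forces_NegI)
              fix k assume k: "h \<le> k" "k \<tturnstile> mem V (Par a)"
              then have "k \<tturnstile> Par b \<^bold>\<lless> Par a"
                using V order_trans[OF order_trans[OF cf fh] k(1)] pts_up[OF ah k(1)] by blast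
              with forces_mono[OF h(2) k(1)] show "k \<tturnstile> \<^bold>\<bottom>" by (rule forces_NegE)
            qed
            then have "h \<tturnstile> mem A (Par a)" using A order_trans[OF df fh] ah by blast
            moreover have "h \<tturnstile> mem W (Par a)" using a(2) h(1) by (rule forces_mono)
            ultimately have "h \<tturnstile> Par a \<^bold>\<sharp> Par a"
              using W(2) fh ah unfolding forces_subset_compl by blast
            then show "h \<tturnstile> \<^bold>\<bottom>" by (rule apart_irrefl)
          qed
        qed
        then show "f \<tturnstile> mem V (Par x)" using V cf xf by blast
      qed (rule substitutive_apart_compl)
    qed
  qed
qed (simp_all add: substitutive_simps)

text \<open>The basic neighbourhoods inside \<open>U\<close> are nearly open by
  \<open>way_above_nearly_open\<close>, so \<open>U\<close> is a union of nearly open sets.\<close>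

lemma scott_open_apartness_topology:
  assumes B: "based c B" and stable: "order_stable c B" and U: "c \<tturnstile> scott_open (mem U)"
  shows "c \<tturnstile> apartness_topology scott_open apart (mem U)"
  unfolding forces_apartness_topology
proof (intro allI impI ballI)
  fix d x assume d: "c \<le> d" and x: "x \<in> pts d" "d \<tturnstile> mem U (Par x)"
  let ?r = "\<^bold>\<exists>\<^sub>s\<^sub>e\<^sub>tV. nearly_open scott_open apart V \<^bold>\<and> V \<^bold>\<subseteq> mem U \<^bold>\<and> V (Par x)"
  show "d \<tturnstile> ?r"
    using based_up[OF B d] forces_mono[OF U d] x
  proof (rule way_above_neighbourhoodE)
    fix e b V assume e: "d \<le> e" and b: "b \<in> pts e" "e \<tturnstile> mem B (Par b)"
      and V: "e \<tturnstile> mem V \<^bold>\<subseteq> mem U" "e \<tturnstile> mem V (Par x)"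
        "\<And>f a. e \<le> f \<Longrightarrow> a \<in> pts f \<Longrightarrow> (f \<tturnstile> mem V (Par a)) \<longleftrightarrow> (f \<tturnstile> Par b \<^bold>\<lless> Par a)"
    note ce = order_trans[OF d e]
    have "e \<tturnstile> nearly_open scott_open apart (mem V)"
      using based_up[OF B ce] order_stable_up[OF stable ce] b V(3) by (rule way_above_nearly_open)
    with V(1,2) show "e \<tturnstile> ?r"
      by (intro forces_ex2I[of _ _ V]) (simp_all add: forces_And substitutive_simps families_syntax)
  qed
qed

section \<open>The derivation without declared points or hypotheses\<close>

theorem theorem4p8:
  shows "{}; {} \<turnstile>
    (\<^bold>\<forall>\<^sub>s\<^sub>e\<^sub>tB. continuous_dcpo \<^bold>\<and> dcpo_basis B \<^bold>\<longrightarrow>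
      (notnot_stable_way_below B \<^bold>\<longrightarrow> notnot_stable_basis scott_open (way_above_family B))
      \<^bold>\<and> (notnot_stable_order B \<^bold>\<longrightarrow> notnot_stable_basis scott_open (way_above_family B))
      \<^bold>\<and> (decidable_way_below B \<^bold>\<longrightarrow> notnot_stable_basis scott_open (way_above_family B))
      \<^bold>\<and> (decidable_order B \<^bold>\<longrightarrow> notnot_stable_basis scott_open (way_above_family B))
      \<^bold>\<and> (notnot_stable_way_below B \<^bold>\<or> notnot_stable_order B
           \<^bold>\<or> decidable_way_below B \<^bold>\<or> decidable_order B \<^bold>\<longrightarrow>
          (\<^bold>\<forall>\<^sub>s\<^sub>e\<^sub>tU. scott_open U \<^bold>\<longleftrightarrow> apartness_topology scott_open apart U)))"
    (is "{}; {} \<turnstile> all2 ?F")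
proof -
  \<comment> \<open>The forcing clause for the quantifier over \<open>B\<close> requires the whole
    body to be substitutive; the bound-name equations collected for all notions come together
    here.\<close>
  have substF: "substitutive2 ?F"
    by (simp add: substitutive_simps families_syntax apartness_topology_syntax notnot_stable_basis_syntax
      conditions_syntax continuous_dcpo_syntax dcpo_basis_syntax)
  have substU: "substitutive2 (\<lambda>U. scott_open U \<^bold>\<longleftrightarrow> apartness_topology scott_open apart U)"
    by (simp add: substitutive_simps apartness_topology_syntax)
  have main: "d \<tturnstile> ?F (mem B)" for d B
    unfolding forces_Imp[of d]
  proof (intro allI impI)
    fix e assume "d \<le> e" "e \<tturnstile> continuous_dcpo \<^bold>\<and> dcpo_basis (mem B)"
    then have e: "based e B" by (simp add: based_def forces_And continuous_dcpo_def dcpo_def)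
    \<comment> \<open>From here on all four conditions are used only through
      \<open>order_stable\<close>.\<close>
    have stable: "order_stable f B"
      if f: "e \<le> f" and *: "(f \<tturnstile> notnot_stable_way_below (mem B)) \<or> (f \<tturnstile> notnot_stable_order (mem B))
        \<or> (f \<tturnstile> decidable_way_below (mem B)) \<or> (f \<tturnstile> decidable_order (mem B))" for f
      using order_stable_conditions[OF based_poset[OF based_up[OF e f]]] * by blast
    have basis: "f \<tturnstile> notnot_stable_basis scott_open (way_above_family (mem B))"
      if "e \<le> f" "order_stable f B" for f
      using notnot_stable_basis_way_above based_up[OF e] that by blast
    have topology: "f \<tturnstile> (\<^bold>\<forall>\<^sub>s\<^sub>e\<^sub>tU. scott_open U \<^bold>\<longleftrightarrow> apartness_topology scott_open apart U)"
      if f: "e \<le> f" "order_stable f B" for f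
      unfolding forces_all2[OF substU] forces_Iff
    proof (intro allI impI)
      fix g U h assume "f \<le> g" "g \<le> h"
      then have "f \<le> h" by (rule order_trans)
      then show "(h \<tturnstile> scott_open (mem U)) \<longleftrightarrow> (h \<tturnstile> apartness_topology scott_open apart (mem U))"
        using scott_open_apartness_topology apartness_topology_scott_open
          based_up[OF e order_trans[OF f(1)]] order_stable_up[OF f(2)] by blast
    qed
    show "e \<tturnstile> (notnot_stable_way_below (mem B) \<^bold>\<longrightarrow> notnot_stable_basis scott_open (way_above_family (mem B)))
      \<^bold>\<and> (notnot_stable_order (mem B) \<^bold>\<longrightarrow> notnot_stable_basis scott_open (way_above_family (mem B)))
      \<^bold>\<and> (decidable_way_below (mem B) \<^bold>\<longrightarrow> notnot_stable_basis scott_open (way_above_family (mem B)))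
      \<^bold>\<and> (decidable_order (mem B) \<^bold>\<longrightarrow> notnot_stable_basis scott_open (way_above_family (mem B)))
      \<^bold>\<and> (notnot_stable_way_below (mem B) \<^bold>\<or> notnot_stable_order (mem B)
           \<^bold>\<or> decidable_way_below (mem B) \<^bold>\<or> decidable_order (mem B) \<^bold>\<longrightarrow>
          (\<^bold>\<forall>\<^sub>s\<^sub>e\<^sub>tU. scott_open U \<^bold>\<longleftrightarrow> apartness_topology scott_open apart U))"
      unfolding forces_And forces_Or_Imp forces_Imp[of e] using basis topology stable by blast
  qed
  \<comment> \<open>Forcing at the empty context is derivability with nothing declared and nothing
    assumed.\<close>
  have "Ctx {||} {||} \<tturnstile> all2 ?F"
    unfolding forces_all2[OF substF] using main by blast
  then show ?thesis by (simp add: forces_def pts_def)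
qed

end
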